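(* Let $\mathcal{C}$ be a skeletally small, idempotent complete triangulated category with suspension $[1]$, and let $\mathcal{X}\subseteq\mathcal{C}$ be an additive subcategory that is contravariantly finite, rigid and closed under direct summands. Put $\mathcal{N}=\mathcal{X}^{\perp_0}=\{C\in\mathcal{C}\mid\mathcal{C}(X,C)=0\ \forall X\in\mathcal{X}\}$. If each object of $\mathcal{C}$ admits a finite $\mathcal{X}$-resolution in $\mathcal{C}^R_{\mathcal{N}}$, then there is an isomorphism of abelian groups $$K_0(\mathcal{C}^R_{\mathcal{N}})\xrightarrow{\ \cong\ }K_0^{\mathsf{sp}}(\mathcal{X}),\qquad [C]^R_{\mathcal{N}}\longmapsto\sum_{i=0}^{m}(-1)^i[X_i]^{\mathsf{sp}},$$ where $X_m\to\cdots\to X_1\to X_0\to C$ is an $\mathcal{X}$-resolution of $C$ in $\mathcal{C}^R_{\mathcal{N}}$ of length $m$; its inverse is given by $[X]^{\mathsf{sp}}\mapsto[X]^R_{\mathcal{N}}$ for $X\in\mathcal{X}$.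
   Context: Subcategories are full and closed under isomorphisms. $\mathcal{X}$ is rigid if $\mathcal{C}(X,X'[1])=0$ for all $X,X'\in\mathcal{X}$; contravariantly finite if every object of $\mathcal{C}$ admits a right $\mathcal{X}$-approximation. $[\mathcal{A}]$ denotes the ideal of morphisms factoring through an object of $\mathcal{A}$. For $A,C\in\mathcal{C}$ let $\mathbb{E}^R_{\mathcal{N}}(C,A)=\{h\colon C\to A[1]\mid y\circ h[-1]\in[\mathcal{N}[-1]]\text{ for all }y\colon A\to N,\ N\in\mathcal{N}\}$. This defines an extriangulated structure $\mathcal{C}^R_{\mathcal{N}}=(\mathcal{C},\mathbb{E}^R_{\mathcal{N}},\mathfrak{s}^R_{\mathcal{N}})$ whose conflations are the sequences $A\to B\to C$ that are part of a triangle $A\to B\to C\xrightarrow{h}A[1]$ with $h\in\mathbb{E}^R_{\mathcal{N}}(C,A)$. $K_0(\mathcal{C}^R_{\mathcal{N}})$ is the abelian group generated by isomorphism classes of objects of $\mathcal{C}$ modulo $[A]-[B]+[C]$ for all these conflations; $[C]^R_{\mathcal{N}}$ is the class of $C$. $K_0^{\mathsf{sp}}(\mathcal{X})$ is the split Grothendieck group: generators $[X]^{\mathsf{sp}}$ for isomorphism classes of $X\in\mathcal{X}$, relations $[X\oplus X']^{\mathsf{sp}}=[X]^{\mathsf{sp}}+[X']^{\mathsf{sp}}$. A finite $\mathcal{X}$-resolution of length $m\ge0$ of $C$ in $\mathcal{C}^R_{\mathcal{N}}$ is a complex $X_m\to\cdots\to X_0\to C$ with $X_i\in\mathcal{X}$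 obtained by splicing conflations $C_{i+1}\to X_i\to C_i$ of $\mathcal{C}^R_{\mathcal{N}}$, $0\le i\le m-1$, with $C_0=C$ and $C_m=X_m$. *)

theory Defs
  imports "HOL-Algebra.Free_Abelian_Groups" "HOL-Algebra.Generated_Groups"
begin

section \<open>Additive categories\<close>

text \<open>The objects and each hom-set of a category form sets over arbitrary HOL types, so the isomorphism
  classes of objects always form a set: skeletal smallness is built in.  \<open>g \<odot> f\<close> is the composite ``first \<open>f\<close>, then \<open>g\<close>''.\<close>

record ('o, 'm) cat =
  Obj :: "'o set"
  Hom :: "'o \<Rightarrow> 'o \<Rightarrow> 'm set"
  idn :: "'o \<Rightarrow> 'm"
  cmp :: "'m \<Rightarrow> 'm \<Rightarrow> 'm" (infixl \<open>\<odot>\<index>\<close> 70)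

locale category = fixes \<C> (structure)
  assumes Hom_Obj: "f \<in> Hom \<C> A B \<Longrightarrow> A \<in> Obj \<C> \<and> B \<in> Obj \<C>"
    and Hom_disjoint: "f \<in> Hom \<C> A B \<Longrightarrow> f \<in> Hom \<C> A' B' \<Longrightarrow> A = A' \<and> B = B'"
    and idn_Hom: "A \<in> Obj \<C> \<Longrightarrow> idn \<C> A \<in> Hom \<C> A A"
    and cmp_Hom: "f \<in> Hom \<C> A B \<Longrightarrow> g \<in> Hom \<C> B D \<Longrightarrow> g \<odot> f \<in> Hom \<C> A D"
    and cmp_idn_right: "f \<in> Hom \<C> A B \<Longrightarrow> f \<odot> idn \<C> A = f"
    and cmp_idn_left: "f \<in> Hom \<C> A B \<Longrightarrow> idn \<C> B \<odot> f = f"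
    and cmp_assoc: "f \<in> Hom \<C> A B \<Longrightarrow> g \<in> Hom \<C> B D \<Longrightarrow> h \<in> Hom \<C> D E
      \<Longrightarrow> (h \<odot> g) \<odot> f = h \<odot> (g \<odot> f)"

definition isomorphism :: "('o, 'm, 'z) cat_scheme \<Rightarrow> 'o \<Rightarrow> 'o \<Rightarrow> 'm \<Rightarrow> bool" where
  "isomorphism \<C> A B f \<longleftrightarrow> f \<in> Hom \<C> A B \<and>
     (\<exists>g\<in>Hom \<C> B A. g \<odot>\<^bsub>\<C>\<^esub> f = idn \<C> A \<and> f \<odot>\<^bsub>\<C>\<^esub> g = idn \<C> B)"

definition isomorphic :: "('o, 'm, 'z) cat_scheme \<Rightarrow> 'o \<Rightarrow> 'o \<Rightarrow> bool" where
  "isomorphic \<C> A B \<longleftrightarrow> (\<exists>f. isomorphism \<C> A B f)"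

definition iso_class :: "('o, 'm, 'z) cat_scheme \<Rightarrow> 'o \<Rightarrow> 'o set" where
  "iso_class \<C> A = {B \<in> Obj \<C>. isomorphic \<C> A B}"

definition idempotent_complete :: "('o, 'm, 'z) cat_scheme \<Rightarrow> bool" where
  "idempotent_complete \<C> \<longleftrightarrow> (\<forall>A\<in>Obj \<C>. \<forall>e\<in>Hom \<C> A A. e \<odot>\<^bsub>\<C>\<^esub> e = e \<longrightarrow>
     (\<exists>B\<in>Obj \<C>. \<exists>r\<in>Hom \<C> A B. \<exists>s\<in>Hom \<C> B A. r \<odot>\<^bsub>\<C>\<^esub> s = idn \<C> B \<and> s \<odot>\<^bsub>\<C>\<^esub> r = e))"

record ('o, 'm) add_cat = "('o, 'm) cat" +
  madd :: "'m \<Rightarrow> 'm \<Rightarrow> 'm" (infixl \<open>\<boxplus>\<index>\<close> 65)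
  mzero :: "'o \<Rightarrow> 'o \<Rightarrow> 'm"

definition hom_group :: "('o, 'm, 'z) add_cat_scheme \<Rightarrow> 'o \<Rightarrow> 'o \<Rightarrow> 'm monoid" where
  "hom_group \<C> A B = \<lparr>carrier = Hom \<C> A B, monoid.mult = madd \<C>, one = mzero \<C> A B\<rparr>"

definition zero_object :: "('o, 'm, 'z) add_cat_scheme \<Rightarrow> 'o \<Rightarrow> bool" where
  "zero_object \<C> Z \<longleftrightarrow> Z \<in> Obj \<C> \<and>
     (\<forall>A\<in>Obj \<C>. Hom \<C> A Z = {mzero \<C> A Z} \<and> Hom \<C> Z A = {mzero \<C> Z A})"

definition biproduct ::
  "('o, 'm, 'z) add_cat_scheme \<Rightarrow> 'o \<Rightarrow> 'o \<Rightarrow> 'o \<Rightarrow> 'm \<Rightarrow> 'm \<Rightarrow> 'm \<Rightarrow> 'm \<Rightarrow> bool" where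
  "biproduct \<C> A B P i j p q \<longleftrightarrow>
     i \<in> Hom \<C> A P \<and> j \<in> Hom \<C> B P \<and> p \<in> Hom \<C> P A \<and> q \<in> Hom \<C> P B \<and>
     p \<odot>\<^bsub>\<C>\<^esub> i = idn \<C> A \<and> q \<odot>\<^bsub>\<C>\<^esub> j = idn \<C> B \<and>
     p \<odot>\<^bsub>\<C>\<^esub> j = mzero \<C> B A \<and> q \<odot>\<^bsub>\<C>\<^esub> i = mzero \<C> A B \<and>
     (i \<odot>\<^bsub>\<C>\<^esub> p) \<boxplus>\<^bsub>\<C>\<^esub> (j \<odot>\<^bsub>\<C>\<^esub> q) = idn \<C> P"

definition direct_sum :: "('o, 'm, 'z) add_cat_scheme \<Rightarrow> 'o \<Rightarrow> 'o \<Rightarrow> 'o \<Rightarrow> bool" where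
  "direct_sum \<C> A B P \<longleftrightarrow> (\<exists>i j p q. biproduct \<C> A B P i j p q)"

locale additive_category = category \<C> for \<C> (structure) +
  assumes hom_comm_group: "A \<in> Obj \<C> \<Longrightarrow> B \<in> Obj \<C> \<Longrightarrow> comm_group (hom_group \<C> A B)"
    and cmp_madd_left: "f \<in> Hom \<C> A B \<Longrightarrow> g \<in> Hom \<C> B D \<Longrightarrow> g' \<in> Hom \<C> B D
      \<Longrightarrow> (g \<boxplus> g') \<odot> f = (g \<odot> f) \<boxplus> (g' \<odot> f)"
    and cmp_madd_right: "f \<in> Hom \<C> A B \<Longrightarrow> f' \<in> Hom \<C> A B \<Longrightarrow> g \<in> Hom \<C> B D
      \<Longrightarrow> g \<odot> (f \<boxplus> f') = (g \<odot> f) \<boxplus> (g \<odot> f')"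
    and zero_object_exists: "\<exists>Z. zero_object \<C> Z"
    and direct_sum_exists: "A \<in> Obj \<C> \<Longrightarrow> B \<in> Obj \<C> \<Longrightarrow> \<exists>P\<in>Obj \<C>. direct_sum \<C> A B P"

definition additive_endofunctor ::
  "('o, 'm, 'z) add_cat_scheme \<Rightarrow> ('o \<Rightarrow> 'o) \<Rightarrow> ('m \<Rightarrow> 'm) \<Rightarrow> bool" where
  "additive_endofunctor \<C> F T \<longleftrightarrow>
     (\<forall>A\<in>Obj \<C>. F A \<in> Obj \<C> \<and> T (idn \<C> A) = idn \<C> (F A)) \<and>
     (\<forall>A\<in>Obj \<C>. \<forall>B\<in>Obj \<C>. T \<in> hom (hom_group \<C> A B) (hom_group \<C> (F A) (F B))) \<and>
     (\<forall>A\<in>Obj \<C>. \<forall>B\<in>Obj \<C>. \<forall>D\<in>Obj \<C>. \<forall>f\<in>Hom \<C> A B. \<forall>g\<in>Hom \<C> B D.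
        T (g \<odot>\<^bsub>\<C>\<^esub> f) = T g \<odot>\<^bsub>\<C>\<^esub> T f)"

text \<open>\<open>t\<close> is a natural isomorphism from the endofunctor \<open>(F, T)\<close> to the identity functor.\<close>

definition nat_iso_to_id ::
  "('o, 'm, 'z) cat_scheme \<Rightarrow> ('o \<Rightarrow> 'o) \<Rightarrow> ('m \<Rightarrow> 'm) \<Rightarrow> ('o \<Rightarrow> 'm) \<Rightarrow> bool" where
  "nat_iso_to_id \<C> F T t \<longleftrightarrow>
     (\<forall>A\<in>Obj \<C>. isomorphism \<C> (F A) A (t A)) \<and>
     (\<forall>A\<in>Obj \<C>. \<forall>B\<in>Obj \<C>. \<forall>f\<in>Hom \<C> A B. t B \<odot>\<^bsub>\<C>\<^esub> T f = f \<odot>\<^bsub>\<C>\<^esub> t A)"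

section \<open>Triangulated categories\<close>

text \<open>The suspension \<open>[1]\<close> is an autoequivalence: \<open>[-1]\<close> is a quasi-inverse, and
  \<open>desusp_susp A : A[1][-1] \<rightarrow> A\<close>, \<open>susp_desusp A : A[-1][1] \<rightarrow> A\<close> are the natural isomorphisms.
  If \<open>[1]\<close> is an automorphism these are identities.  A triple \<open>(f, g, h)\<close> in \<open>dist\<close> is a
  distinguished triangle; its objects are determined by the morphisms.\<close>

record ('o, 'm) tri_cat = "('o, 'm) add_cat" +
  susp :: "'o \<Rightarrow> 'o"
  suspM :: "'m \<Rightarrow> 'm"
  desusp :: "'o \<Rightarrow> 'o"
  desuspM :: "'m \<Rightarrow> 'm"
  desusp_susp :: "'o \<Rightarrow> 'm"
  susp_desusp :: "'o \<Rightarrow> 'm"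
  dist :: "('m \<times> 'm \<times> 'm) set"

definition candidate ::
  "('o, 'm, 'z) tri_cat_scheme \<Rightarrow> 'o \<Rightarrow> 'o \<Rightarrow> 'o \<Rightarrow> 'm \<Rightarrow> 'm \<Rightarrow> 'm \<Rightarrow> bool" where
  "candidate \<C> A B D f g h \<longleftrightarrow>
     f \<in> Hom \<C> A B \<and> g \<in> Hom \<C> B D \<and> h \<in> Hom \<C> D (susp \<C> A)"

definition triangle ::
  "('o, 'm, 'z) tri_cat_scheme \<Rightarrow> 'o \<Rightarrow> 'o \<Rightarrow> 'o \<Rightarrow> 'm \<Rightarrow> 'm \<Rightarrow> 'm \<Rightarrow> bool" where
  "triangle \<C> A B D f g h \<longleftrightarrow> candidate \<C> A B D f g h \<and> (f, g, h) \<in> dist \<C>"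

locale triangulated_category = additive_category \<C> for \<C> (structure) +
  assumes susp_functor: "additive_endofunctor \<C> (susp \<C>) (suspM \<C>)"
    and desusp_functor: "additive_endofunctor \<C> (desusp \<C>) (desuspM \<C>)"
    and desusp_susp_iso: "nat_iso_to_id \<C> (desusp \<C> \<circ> susp \<C>) (desuspM \<C> \<circ> suspM \<C>) (desusp_susp \<C>)"
    and susp_desusp_iso: "nat_iso_to_id \<C> (susp \<C> \<circ> desusp \<C>) (suspM \<C> \<circ> desuspM \<C>) (susp_desusp \<C>)"
    and dist_candidate: "(f, g, h) \<in> dist \<C> \<Longrightarrow> \<exists>A B D. candidate \<C> A B D f g h"
    and TR_iso: "triangle \<C> A B D f g h \<Longrightarrow> candidate \<C> A' B' D' f' g' h' \<Longrightarrow>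
      isomorphism \<C> A A' a \<Longrightarrow> isomorphism \<C> B B' b \<Longrightarrow> isomorphism \<C> D D' d \<Longrightarrow>
      b \<odot> f = f' \<odot> a \<Longrightarrow> d \<odot> g = g' \<odot> b \<Longrightarrow> suspM \<C> a \<odot> h = h' \<odot> d \<Longrightarrow>
      triangle \<C> A' B' D' f' g' h'"
    and TR1_idn: "A \<in> Obj \<C> \<Longrightarrow> zero_object \<C> Z \<Longrightarrow>
      triangle \<C> A A Z (idn \<C> A) (mzero \<C> A Z) (mzero \<C> Z (susp \<C> A))"
    and TR1_cone: "f \<in> Hom \<C> A B \<Longrightarrow> \<exists>D g h. triangle \<C> A B D f g h"
    and TR2: "candidate \<C> A B D f g h \<Longrightarrow>
      triangle \<C> A B D f g h \<longleftrightarrow>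
      triangle \<C> B D (susp \<C> A) g h (inv\<^bsub>hom_group \<C> (susp \<C> A) (susp \<C> B)\<^esub> (suspM \<C> f))"
    and TR3: "triangle \<C> A B D f g h \<Longrightarrow> triangle \<C> A' B' D' f' g' h' \<Longrightarrow>
      a \<in> Hom \<C> A A' \<Longrightarrow> b \<in> Hom \<C> B B' \<Longrightarrow> b \<odot> f = f' \<odot> a \<Longrightarrow>
      \<exists>d\<in>Hom \<C> D D'. d \<odot> g = g' \<odot> b \<and> suspM \<C> a \<odot> h = h' \<odot> d"
    and TR4: "triangle \<C> A B D f f1 f2 \<Longrightarrow> triangle \<C> B K F g g1 g2 \<Longrightarrow>
      triangle \<C> A K E (g \<odot> f) e1 e2 \<Longrightarrow>
      \<exists>u v. triangle \<C> D E F u v (suspM \<C> f1 \<odot> g2) \<and>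
        u \<odot> f1 = e1 \<odot> g \<and> e2 \<odot> u = f2 \<and> v \<odot> e1 = g1 \<and> g2 \<odot> v = suspM \<C> f \<odot> e2"

section \<open>Subcategories\<close>

text \<open>Subcategories are full and closed under isomorphisms, hence given by their objects.\<close>

definition subcategory :: "('o, 'm, 'z) cat_scheme \<Rightarrow> 'o set \<Rightarrow> bool" where
  "subcategory \<C> \<XX> \<longleftrightarrow> \<XX> \<subseteq> Obj \<C> \<and>
     (\<forall>A\<in>\<XX>. \<forall>B\<in>Obj \<C>. isomorphic \<C> A B \<longrightarrow> B \<in> \<XX>)"

definition additive_subcategory :: "('o, 'm, 'z) add_cat_scheme \<Rightarrow> 'o set \<Rightarrow> bool" where
  "additive_subcategory \<C> \<XX> \<longleftrightarrow> subcategory \<C> \<XX> \<and>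
     (\<forall>Z. zero_object \<C> Z \<longrightarrow> Z \<in> \<XX>) \<and>
     (\<forall>A\<in>\<XX>. \<forall>B\<in>\<XX>. \<forall>P\<in>Obj \<C>. direct_sum \<C> A B P \<longrightarrow> P \<in> \<XX>)"

definition closed_under_summands :: "('o, 'm, 'z) add_cat_scheme \<Rightarrow> 'o set \<Rightarrow> bool" where
  "closed_under_summands \<C> \<XX> \<longleftrightarrow>
     (\<forall>P\<in>\<XX>. \<forall>A\<in>Obj \<C>. \<forall>B\<in>Obj \<C>. direct_sum \<C> A B P \<longrightarrow> A \<in> \<XX> \<and> B \<in> \<XX>)"

definition right_approximation ::
  "('o, 'm, 'z) cat_scheme \<Rightarrow> 'o set \<Rightarrow> 'o \<Rightarrow> 'o \<Rightarrow> 'm \<Rightarrow> bool" where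
  "right_approximation \<C> \<XX> X A f \<longleftrightarrow> X \<in> \<XX> \<and> f \<in> Hom \<C> X A \<and>
     (\<forall>X'\<in>\<XX>. \<forall>g\<in>Hom \<C> X' A. \<exists>t\<in>Hom \<C> X' X. g = f \<odot>\<^bsub>\<C>\<^esub> t)"

definition contravariantly_finite :: "('o, 'm, 'z) cat_scheme \<Rightarrow> 'o set \<Rightarrow> bool" where
  "contravariantly_finite \<C> \<XX> \<longleftrightarrow> (\<forall>A\<in>Obj \<C>. \<exists>X f. right_approximation \<C> \<XX> X A f)"

definition rigid :: "('o, 'm, 'z) tri_cat_scheme \<Rightarrow> 'o set \<Rightarrow> bool" where
  "rigid \<C> \<XX> \<longleftrightarrow>
     (\<forall>X\<in>\<XX>. \<forall>X'\<in>\<XX>. Hom \<C> X (susp \<C> X') = {mzero \<C> X (susp \<C> X')})"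

definition perp0 :: "('o, 'm, 'z) add_cat_scheme \<Rightarrow> 'o set \<Rightarrow> 'o set" where
  "perp0 \<C> \<XX> = {A \<in> Obj \<C>. \<forall>X\<in>\<XX>. Hom \<C> X A = {mzero \<C> X A}}"

text \<open>The ideal \<open>[\<A>](A, B)\<close> of morphisms \<open>A \<rightarrow> B\<close> that factor through an object of \<open>\<A>\<close>.\<close>

definition factor_ideal :: "('o, 'm, 'z) cat_scheme \<Rightarrow> 'o set \<Rightarrow> 'o \<Rightarrow> 'o \<Rightarrow> 'm set" where
  "factor_ideal \<C> \<A> A B =
     {g \<odot>\<^bsub>\<C>\<^esub> f | f g. \<exists>Y\<in>\<A>. f \<in> Hom \<C> A Y \<and> g \<in> Hom \<C> Y B}"

definition desusp_subcategory :: "('o, 'm, 'z) tri_cat_scheme \<Rightarrow> 'o set \<Rightarrow> 'o set" where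
  "desusp_subcategory \<C> \<N> = {Y \<in> Obj \<C>. \<exists>N\<in>\<N>. isomorphic \<C> (desusp \<C> N) Y}"

section \<open>The relative extriangulated structure and Grothendieck groups\<close>

text \<open>For \<open>h : D \<rightarrow> A[1]\<close>, the morphism \<open>h[-1] : D[-1] \<rightarrow> A\<close> (with \<open>A[1][-1]\<close> identified with
  \<open>A\<close>).\<close>

definition desusp_to :: "('o, 'm, 'z) tri_cat_scheme \<Rightarrow> 'o \<Rightarrow> 'm \<Rightarrow> 'm" where
  "desusp_to \<C> A h = desusp_susp \<C> A \<odot>\<^bsub>\<C>\<^esub> desuspM \<C> h"

definition ER :: "('o, 'm, 'z) tri_cat_scheme \<Rightarrow> 'o set \<Rightarrow> 'o \<Rightarrow> 'o \<Rightarrow> 'm set" where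
  "ER \<C> \<N> D A = {h \<in> Hom \<C> D (susp \<C> A). \<forall>N\<in>\<N>. \<forall>y\<in>Hom \<C> A N.
     y \<odot>\<^bsub>\<C>\<^esub> desusp_to \<C> A h
       \<in> factor_ideal \<C> (desusp_subcategory \<C> \<N>) (desusp \<C> D) N}"

definition conflationR ::
  "('o, 'm, 'z) tri_cat_scheme \<Rightarrow> 'o set \<Rightarrow> 'o \<Rightarrow> 'o \<Rightarrow> 'o \<Rightarrow> 'm \<Rightarrow> 'm \<Rightarrow> bool" where
  "conflationR \<C> \<N> A B D f g \<longleftrightarrow> (\<exists>h\<in>ER \<C> \<N> D A. triangle \<C> A B D f g h)"

text \<open>Abelian groups are written multiplicatively in HOL-Algebra; the elements of the free
  abelian group itself are written additively.\<close>

definition K0R_relations :: "('o, 'm, 'z) tri_cat_scheme \<Rightarrow> 'o set \<Rightarrow> ('o set \<Rightarrow>\<^sub>0 int) set" where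
  "K0R_relations \<C> \<N> =
     {frag_of (iso_class \<C> A) - frag_of (iso_class \<C> B) + frag_of (iso_class \<C> D)
       | A B D. \<exists>f g. conflationR \<C> \<N> A B D f g}"

definition K0R_subgroup :: "('o, 'm, 'z) tri_cat_scheme \<Rightarrow> 'o set \<Rightarrow> ('o set \<Rightarrow>\<^sub>0 int) set" where
  "K0R_subgroup \<C> \<N> =
     generate (free_Abelian_group (iso_class \<C> ` Obj \<C>)) (K0R_relations \<C> \<N>)"

definition K0R :: "('o, 'm, 'z) tri_cat_scheme \<Rightarrow> 'o set \<Rightarrow> ('o set \<Rightarrow>\<^sub>0 int) set monoid" where
  "K0R \<C> \<N> = free_Abelian_group (iso_class \<C> ` Obj \<C>) Mod K0R_subgroup \<C> \<N>"

definition K0R_class ::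
  "('o, 'm, 'z) tri_cat_scheme \<Rightarrow> 'o set \<Rightarrow> 'o \<Rightarrow> ('o set \<Rightarrow>\<^sub>0 int) set" where
  "K0R_class \<C> \<N> A =
     K0R_subgroup \<C> \<N> #>\<^bsub>free_Abelian_group (iso_class \<C> ` Obj \<C>)\<^esub> frag_of (iso_class \<C> A)"

definition K0sp_relations :: "('o, 'm, 'z) add_cat_scheme \<Rightarrow> 'o set \<Rightarrow> ('o set \<Rightarrow>\<^sub>0 int) set" where
  "K0sp_relations \<C> \<XX> =
     {frag_of (iso_class \<C> P) - (frag_of (iso_class \<C> X) + frag_of (iso_class \<C> X'))
       | P X X'. P \<in> \<XX> \<and> X \<in> \<XX> \<and> X' \<in> \<XX> \<and> direct_sum \<C> X X' P}"

definition K0sp_subgroup :: "('o, 'm, 'z) add_cat_scheme \<Rightarrow> 'o set \<Rightarrow> ('o set \<Rightarrow>\<^sub>0 int) set" where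
  "K0sp_subgroup \<C> \<XX> =
     generate (free_Abelian_group (iso_class \<C> ` \<XX>)) (K0sp_relations \<C> \<XX>)"

definition K0sp :: "('o, 'm, 'z) add_cat_scheme \<Rightarrow> 'o set \<Rightarrow> ('o set \<Rightarrow>\<^sub>0 int) set monoid" where
  "K0sp \<C> \<XX> = free_Abelian_group (iso_class \<C> ` \<XX>) Mod K0sp_subgroup \<C> \<XX>"

definition K0sp_class ::
  "('o, 'm, 'z) add_cat_scheme \<Rightarrow> 'o set \<Rightarrow> 'o \<Rightarrow> ('o set \<Rightarrow>\<^sub>0 int) set" where
  "K0sp_class \<C> \<XX> X =
     K0sp_subgroup \<C> \<XX> #>\<^bsub>free_Abelian_group (iso_class \<C> ` \<XX>)\<^esub> frag_of (iso_class \<C> X)"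

text \<open>The complex \<open>X m \<rightarrow> \<dots> \<rightarrow> X 0 \<rightarrow> A\<close> has differentials \<open>d (Suc i) : X (Suc i) \<rightarrow> X i\<close> and
  augmentation \<open>d 0 : X 0 \<rightarrow> A\<close>, spliced from conflations \<open>K (Suc i) \<rightarrow> X i \<rightarrow> K i\<close>.  As
  \<open>K m = X m\<close>, the deflation onto \<open>K m\<close> is the identity; in particular a resolution of length \<open>0\<close>
  is the identity \<open>A = X 0 \<rightarrow> A\<close>.\<close>

definition resolutionR ::
  "('o, 'm, 'z) tri_cat_scheme \<Rightarrow> 'o set \<Rightarrow> 'o set \<Rightarrow> 'o \<Rightarrow> nat \<Rightarrow> (nat \<Rightarrow> 'o) \<Rightarrow> (nat \<Rightarrow> 'm) \<Rightarrow> bool" where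
  "resolutionR \<C> \<N> \<XX> A m X d \<longleftrightarrow> (\<forall>i\<le>m. X i \<in> \<XX>) \<and>
     (\<exists>K f g. K 0 = A \<and> K m = X m \<and> g m = idn \<C> (X m) \<and>
        (\<forall>i<m. conflationR \<C> \<N> (K (Suc i)) (X i) (K i) (f i) (g i)) \<and>
        d 0 = g 0 \<and> (\<forall>i<m. d (Suc i) = f i \<odot>\<^bsub>\<C>\<^esub> g (Suc i)))"

lemma (in category) isomorphic_trans:
  assumes "isomorphic \<C> A B" "isomorphic \<C> B D"
  shows "isomorphic \<C> A D"
proof -
  obtain f f' where f: "f \<in> Hom \<C> A B" "f' \<in> Hom \<C> B A" "f' \<odot> f = idn \<C> A" "f \<odot> f' = idn \<C> B"
    using assms(1) by (auto simp: isomorphic_def isomorphism_def)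
  obtain g g' where g: "g \<in> Hom \<C> B D" "g' \<in> Hom \<C> D B" "g' \<odot> g = idn \<C> B" "g \<odot> g' = idn \<C> D"
    using assms(2) by (auto simp: isomorphic_def isomorphism_def)
  have gf: "g \<odot> f \<in> Hom \<C> A D" "f' \<odot> g' \<in> Hom \<C> D A"
    using f g cmp_Hom by blast+
  have "(f' \<odot> g') \<odot> (g \<odot> f) = f' \<odot> ((g' \<odot> g) \<odot> f)"
    using cmp_assoc[OF gf(1) g(2) f(2)] cmp_assoc[OF f(1) g(1) g(2)] by simp
  then have "(f' \<odot> g') \<odot> (g \<odot> f) = idn \<C> A"
    using f g cmp_idn_left by simp
  moreover have "(g \<odot> f) \<odot> (f' \<odot> g') = g \<odot> ((f \<odot> f') \<odot> g')"
    using cmp_assoc[OF gf(2) f(1) g(1)] cmp_assoc[OF g(2) f(2) f(1)] by simp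
  then have "(g \<odot> f) \<odot> (f' \<odot> g') = idn \<C> D"
    using f g cmp_idn_left by simp
  ultimately have "isomorphism \<C> A D (g \<odot> f)"
    unfolding isomorphism_def using gf by blast
  then show ?thesis by (auto simp: isomorphic_def)
qed

lemma (in category) iso_class_eq_iff:
  assumes "A \<in> Obj \<C>" "B \<in> Obj \<C>"
  shows "iso_class \<C> A = iso_class \<C> B \<longleftrightarrow> isomorphic \<C> A B"
proof -
  have refl: "isomorphic \<C> D D" if "D \<in> Obj \<C>" for D
    unfolding isomorphic_def isomorphism_def
    using idn_Hom[OF that] cmp_idn_left[OF idn_Hom[OF that]] by blast
  have sym: "isomorphic \<C> D E \<Longrightarrow> isomorphic \<C> E D" for D E
    by (auto simp: isomorphic_def isomorphism_def)
  show ?thesis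
  proof
    assume "iso_class \<C> A = iso_class \<C> B"
    moreover have "B \<in> iso_class \<C> B" using assms refl by (simp add: iso_class_def)
    ultimately have "B \<in> iso_class \<C> A" by simp
    then show "isomorphic \<C> A B" by (simp add: iso_class_def)
  next
    assume AB: "isomorphic \<C> A B"
    have "isomorphic \<C> A D \<longleftrightarrow> isomorphic \<C> B D" for D
      using isomorphic_trans[OF AB] isomorphic_trans[OF sym[OF AB]] by metis
    then show "iso_class \<C> A = iso_class \<C> B" by (simp add: iso_class_def)
  qed
qed

lemma comm_group_free_Abelian_group_Mod:
  assumes "R \<subseteq> carrier (free_Abelian_group S)"
  shows "comm_group (free_Abelian_group S Mod generate (free_Abelian_group S) R)"
  by (simp add: abelian_free_Abelian_group assms comm_group.abelian_FactGroup
      group.generate_is_subgroup)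

lemma (in triangulated_category) comm_group_K0R: "comm_group (K0R \<C> \<N>)"
  unfolding K0R_def K0R_subgroup_def
proof (rule comm_group_free_Abelian_group_Mod)
  have "frag_of (iso_class \<C> A) - frag_of (iso_class \<C> B) + frag_of (iso_class \<C> D)
      \<in> carrier (free_Abelian_group (iso_class \<C> ` Obj \<C>))"
    if "conflationR \<C> \<N> A B D f g" for A B D f g
  proof -
    have "A \<in> Obj \<C>" "B \<in> Obj \<C>" "D \<in> Obj \<C>"
      using that Hom_Obj by (auto simp: conflationR_def triangle_def candidate_def)
    then have "Poly_Mapping.keys (frag_of (iso_class \<C> A) - frag_of (iso_class \<C> B)) \<subseteq> iso_class \<C> ` Obj \<C>"
      by (intro order_trans[OF keys_diff]) auto
    with \<open>D \<in> Obj \<C>\<close> show ?thesis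
      unfolding carrier_free_Abelian_group_iff by (intro order_trans[OF keys_add]) auto
  qed
  then show "K0R_relations \<C> \<N> \<subseteq> carrier (free_Abelian_group (iso_class \<C> ` Obj \<C>))"
    unfolding K0R_relations_def by blast
qed

lemma comm_group_K0sp: "comm_group (K0sp \<C> \<XX>)"
  unfolding K0sp_def K0sp_subgroup_def
proof (rule comm_group_free_Abelian_group_Mod)
  have "frag_of (iso_class \<C> P) - (frag_of (iso_class \<C> X) + frag_of (iso_class \<C> X'))
      \<in> carrier (free_Abelian_group (iso_class \<C> ` \<XX>))"
    if "P \<in> \<XX>" "X \<in> \<XX>" "X' \<in> \<XX>" for P X X'
  proof -
    have "Poly_Mapping.keys (frag_of (iso_class \<C> X) + frag_of (iso_class \<C> X')) \<subseteq> iso_class \<C> ` \<XX>"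
      using that by (intro order_trans[OF keys_add]) auto
    with that show ?thesis
      unfolding carrier_free_Abelian_group_iff by (intro order_trans[OF keys_diff]) auto
  qed
  then show "K0sp_relations \<C> \<XX> \<subseteq> carrier (free_Abelian_group (iso_class \<C> ` \<XX>))"
    unfolding K0sp_relations_def by blast
qed

end

theory Submission
  imports Defs
begin

text \<open>
  \<^bold>\<open>Conflations.\<close>  A triangle \<open>A \<rightarrow> B \<rightarrow> C\<close> with connecting morphism \<open>h\<close> is a conflation of the relative
  structure precisely when \<open>h\<close> is an \<open>\<XX>\<close>-ghost, that is, \<open>h a = 0\<close> for every \<open>a : X \<rightarrow> C\<close> with \<open>X \<in> \<XX>\<close>
  (\<open>ER_iff_ghost\<close>).  This rests on the triangles \<open>X \<rightarrow> A \<rightarrow> N\<close> over right approximations, whose cones lie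
  in \<open>\<N>\<close> by rigidity.  Objects of \<open>\<XX>\<close> are therefore projective: a conflation ending in \<open>\<XX>\<close> splits
  (\<open>conflation_splits\<close>).

  \<^bold>\<open>The resolution theorem.\<close>  What remains is the classical statement that the Grothendieck group of
  a category in which every object has a finite projective resolution is the split Grothendieck group
  of the projectives.  Besides projectivity its proof uses that deflations compose and are stable
  under pullback; both facts are the octahedral axiom, brought to the form \<open>octahedron\<close> by rotating
  triangles backwards.  The alternating sum of a resolution is independent of the resolution by Schanuel's
  argument (\<open>euler_unique\<close>), and it is additive on a conflation \<open>A \<rightarrow> B \<rightarrow> C\<close> by induction on the
  lengths of resolutions of \<open>A\<close> and \<open>C\<close> (\<open>euler_conflation\<close>).  Pulling the first step \<open>X \<rightarrow> C\<close> back along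
  \<open>B \<rightarrow> C\<close> produces a conflation \<open>K \<rightarrow> P \<rightarrow> B\<close>, where \<open>K\<close> is the syzygy of \<open>C\<close> and \<open>P\<close> is a direct sum of
  \<open>A\<close> and \<open>X\<close>; composing with a first step onto \<open>P\<close> gives one onto \<open>B\<close>, and its syzygy is an
  extension of shorter objects.

  \<^bold>\<open>The isomorphism.\<close>  Additivity makes the alternating sum a homomorphism out of the relative
  Grothendieck group, and the inclusion of \<open>\<XX>\<close> induces a homomorphism the other way because direct
  sums are conflations.  They are mutually inverse on generators: an object of \<open>\<XX>\<close> is its own
  resolution, and the conflations of a resolution write the class of an object as the alternating sum
  (\<open>inclusion_hom_euler\<close>).
\<close>

section \<open>Arithmetic in additive categories\<close>

context additive_category
begin

lemma hom_group_sel: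
  "carrier (hom_group \<C> A B) = Hom \<C> A B"
  "monoid.mult (hom_group \<C> A B) = madd \<C>"
  "one (hom_group \<C> A B) = mzero \<C> A B"
  by (simp_all add: hom_group_def)

lemma hom_group_comm: "f \<in> Hom \<C> A B \<Longrightarrow> comm_group (hom_group \<C> A B)"
  using hom_comm_group Hom_Obj by blast

lemma mzero_Hom: "A \<in> Obj \<C> \<Longrightarrow> B \<in> Obj \<C> \<Longrightarrow> mzero \<C> A B \<in> Hom \<C> A B"
  using group.is_monoid[OF comm_group.axioms(2)[OF hom_comm_group], THEN monoid.one_closed, of A B]
  by (simp add: hom_group_sel)

abbreviation neg :: "'a \<Rightarrow> 'a \<Rightarrow> 'b \<Rightarrow> 'b" where
  "neg A B f \<equiv> inv\<^bsub>hom_group \<C> A B\<^esub> f"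

context
  fixes A B f assumes f: "f \<in> Hom \<C> A B"
begin

interpretation H: comm_group "hom_group \<C> A B"
  using hom_group_comm[OF f] .

lemma madd_closed: "g \<in> Hom \<C> A B \<Longrightarrow> f \<boxplus> g \<in> Hom \<C> A B"
  using H.m_closed[of f g] f by (simp add: hom_group_sel)

lemma madd_mzero_right: "f \<boxplus> mzero \<C> A B = f"
  using H.r_one[of f] f by (simp add: hom_group_sel)

lemma madd_mzero_left: "mzero \<C> A B \<boxplus> f = f"
  using H.l_one[of f] f by (simp add: hom_group_sel)

lemma madd_comm: "g \<in> Hom \<C> A B \<Longrightarrow> f \<boxplus> g = g \<boxplus> f"
  using H.m_comm[of f g] f by (simp add: hom_group_sel)

lemma neg_Hom: "neg A B f \<in> Hom \<C> A B"
  using H.inv_closed[of f] f by (simp add: hom_group_sel)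

lemma madd_neg: "f \<boxplus> neg A B f = mzero \<C> A B"
  using H.r_inv[of f] f by (simp add: hom_group_sel)

lemma neg_neg: "neg A B (neg A B f) = f"
  using H.inv_inv[of f] f by (simp add: hom_group_sel)

lemma neg_unique: "g \<in> Hom \<C> A B \<Longrightarrow> f \<boxplus> g = mzero \<C> A B \<Longrightarrow> g = neg A B f"
  using H.inv_equality[of g f] f madd_comm[of g] by (simp add: hom_group_sel)

lemma idem_mzero: "f \<boxplus> f = f \<Longrightarrow> f = mzero \<C> A B"
  using H.l_cancel_one[of f f] f by (simp add: hom_group_sel)

end

lemma cmp_mzero_right:
  assumes "f \<in> Hom \<C> B D" "A \<in> Obj \<C>"
  shows "f \<odot> mzero \<C> A B = mzero \<C> A D"
proof (rule idem_mzero)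
  have z: "mzero \<C> A B \<in> Hom \<C> A B" using assms mzero_Hom Hom_Obj by blast
  show "f \<odot> mzero \<C> A B \<in> Hom \<C> A D" using z assms cmp_Hom by blast
  show "f \<odot> mzero \<C> A B \<boxplus> f \<odot> mzero \<C> A B = f \<odot> mzero \<C> A B"
    using cmp_madd_right[OF z z assms(1)] madd_mzero_right[OF z] by simp
qed

lemma cmp_mzero_left:
  assumes "f \<in> Hom \<C> A B" "D \<in> Obj \<C>"
  shows "mzero \<C> B D \<odot> f = mzero \<C> A D"
proof (rule idem_mzero)
  have z: "mzero \<C> B D \<in> Hom \<C> B D" using assms mzero_Hom Hom_Obj by blast
  show "mzero \<C> B D \<odot> f \<in> Hom \<C> A D" using z assms cmp_Hom by blast
  show "mzero \<C> B D \<odot> f \<boxplus> mzero \<C> B D \<odot> f = mzero \<C> B D \<odot> f"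
    using cmp_madd_left[OF assms(1) z z] madd_mzero_right[OF z] by simp
qed

lemma cmp_neg_right:
  assumes "f \<in> Hom \<C> A B" "g \<in> Hom \<C> B D"
  shows "g \<odot> neg A B f = neg A D (g \<odot> f)"
proof (rule neg_unique)
  have n: "neg A B f \<in> Hom \<C> A B" using assms neg_Hom by blast
  show "g \<odot> f \<in> Hom \<C> A D" "g \<odot> neg A B f \<in> Hom \<C> A D" using assms n cmp_Hom by blast+
  show "g \<odot> f \<boxplus> g \<odot> neg A B f = mzero \<C> A D"
    using cmp_madd_right[OF assms(1) n assms(2)] madd_neg[OF assms(1)]
      cmp_mzero_right[OF assms(2)] Hom_Obj[OF assms(1)] by simp
qed

lemma cmp_neg_left:
  assumes "f \<in> Hom \<C> A B" "g \<in> Hom \<C> B D"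
  shows "neg B D g \<odot> f = neg A D (g \<odot> f)"
proof (rule neg_unique)
  have n: "neg B D g \<in> Hom \<C> B D" using assms neg_Hom by blast
  show "g \<odot> f \<in> Hom \<C> A D" "neg B D g \<odot> f \<in> Hom \<C> A D" using assms n cmp_Hom by blast+
  show "g \<odot> f \<boxplus> neg B D g \<odot> f = mzero \<C> A D"
    using cmp_madd_left[OF assms(1) assms(2) n] madd_neg[OF assms(2)]
      cmp_mzero_left[OF assms(1)] Hom_Obj[OF assms(2)] by simp
qed

lemma neg_mzero: "A \<in> Obj \<C> \<Longrightarrow> B \<in> Obj \<C> \<Longrightarrow> neg A B (mzero \<C> A B) = mzero \<C> A B"
  by (rule sym, rule neg_unique[OF mzero_Hom mzero_Hom madd_mzero_left[OF mzero_Hom]])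

lemma isomorphism_idn: "A \<in> Obj \<C> \<Longrightarrow> isomorphism \<C> A A (idn \<C> A)"
  unfolding isomorphism_def using idn_Hom cmp_idn_left by metis

lemma iso_cancel_left:
  assumes "isomorphism \<C> B D t" "f \<in> Hom \<C> A B" "g \<in> Hom \<C> A B" "t \<odot> f = t \<odot> g"
  shows "f = g"
proof -
  obtain s where s: "t \<in> Hom \<C> B D" "s \<in> Hom \<C> D B" "s \<odot> t = idn \<C> B"
    using assms(1) by (auto simp: isomorphism_def)
  have "s \<odot> (t \<odot> f) = s \<odot> (t \<odot> g)" using assms by simp
  then show ?thesis using cmp_assoc[OF assms(2) s(1,2)] cmp_assoc[OF assms(3) s(1,2)] s
      cmp_idn_left assms by metis
qed

lemma iso_cancel_right:
  assumes "isomorphism \<C> A B t" "f \<in> Hom \<C> B D" "g \<in> Hom \<C> B D" "f \<odot> t = g \<odot> t"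
  shows "f = g"
proof -
  obtain s where s: "t \<in> Hom \<C> A B" "s \<in> Hom \<C> B A" "t \<odot> s = idn \<C> B"
    using assms(1) by (auto simp: isomorphism_def)
  have "(f \<odot> t) \<odot> s = (g \<odot> t) \<odot> s" using assms by simp
  then show ?thesis using cmp_assoc[OF s(2,1) assms(2)] cmp_assoc[OF s(2,1) assms(3)] s
      cmp_idn_right assms by metis
qed

lemma zero_objectD:
  assumes "zero_object \<C> Z" "f \<in> Hom \<C> Z A"
  shows "f = mzero \<C> Z A"
  using assms Hom_Obj by (auto simp: zero_object_def)

lemma zero_object_if_idn:
  assumes "Z \<in> Obj \<C>" "idn \<C> Z = mzero \<C> Z Z"
  shows "zero_object \<C> Z"
proof -
  have "f = mzero \<C> A Z" if "f \<in> Hom \<C> A Z" for f A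
    using cmp_idn_left[OF that] cmp_mzero_left[OF that assms(1)] assms(2) by simp
  moreover have "f = mzero \<C> Z A" if "f \<in> Hom \<C> Z A" for f A
    using cmp_idn_right[OF that] cmp_mzero_right[OF that assms(1)] assms(2) by simp
  ultimately show ?thesis using assms mzero_Hom unfolding zero_object_def by blast
qed

lemma zero_object_idn: "zero_object \<C> Z \<Longrightarrow> idn \<C> Z = mzero \<C> Z Z"
  by (rule zero_objectD[OF _ idn_Hom]) (simp_all add: zero_object_def)

lemma biproduct_sym:
  assumes "biproduct \<C> A B P i j p q"
  shows "biproduct \<C> B A P j i q p"
proof -
  have h: "i \<in> Hom \<C> A P" "j \<in> Hom \<C> B P" "p \<in> Hom \<C> P A" "q \<in> Hom \<C> P B"
    using assms by (auto simp: biproduct_def)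
  from madd_comm[OF cmp_Hom[OF h(3,1)] cmp_Hom[OF h(4,2)]] show ?thesis
    using assms unfolding biproduct_def by simp
qed

text \<open>The diagonal matrices with identity entries between two biproducts of \<open>A\<close> and \<open>B\<close> are mutually
  inverse.\<close>

lemma biproduct_matrix_cmp:
  assumes "biproduct \<C> A B P i j p q" "biproduct \<C> A B Q i' j' p' q'"
  shows "((i \<odot> p') \<boxplus> (j \<odot> q')) \<odot> ((i' \<odot> p) \<boxplus> (j' \<odot> q)) = idn \<C> P"
proof -
  have h: "i \<in> Hom \<C> A P" "j \<in> Hom \<C> B P" "p \<in> Hom \<C> P A" "q \<in> Hom \<C> P B"
      "i' \<in> Hom \<C> A Q" "j' \<in> Hom \<C> B Q" "p' \<in> Hom \<C> Q A" "q' \<in> Hom \<C> Q B"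
      "p' \<odot> i' = idn \<C> A" "q' \<odot> j' = idn \<C> B" "p' \<odot> j' = mzero \<C> B A" "q' \<odot> i' = mzero \<C> A B"
      "(i \<odot> p) \<boxplus> (j \<odot> q) = idn \<C> P"
    using assms by (auto simp: biproduct_def)
  have o: "A \<in> Obj \<C>" "B \<in> Obj \<C>" "P \<in> Obj \<C>" "Q \<in> Obj \<C>"
    using Hom_Obj[OF h(1)] Hom_Obj[OF h(6)] by simp_all
  have c: "i \<odot> p' \<in> Hom \<C> Q P" "j \<odot> q' \<in> Hom \<C> Q P" "i' \<odot> p \<in> Hom \<C> P Q" "j' \<odot> q \<in> Hom \<C> P Q"
      "i \<odot> p \<in> Hom \<C> P P" "j \<odot> q \<in> Hom \<C> P P"
    using cmp_Hom[OF h(7,1)] cmp_Hom[OF h(8,2)] cmp_Hom[OF h(3,5)] cmp_Hom[OF h(4,6)]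
      cmp_Hom[OF h(3,1)] cmp_Hom[OF h(4,2)] by simp_all
  have s: "(i \<odot> p') \<boxplus> (j \<odot> q') \<in> Hom \<C> Q P" using madd_closed[OF c(1,2)] .
  have "((i \<odot> p') \<boxplus> (j \<odot> q')) \<odot> (i' \<odot> p) = ((i \<odot> p') \<odot> (i' \<odot> p)) \<boxplus> ((j \<odot> q') \<odot> (i' \<odot> p))"
    using cmp_madd_left[OF c(3) c(1,2)] .
  also have "(i \<odot> p') \<odot> (i' \<odot> p) = i \<odot> p"
    using cmp_assoc[OF c(3) h(7) h(1)] cmp_assoc[OF h(3) h(5) h(7)] h cmp_idn_left by simp
  also have "(j \<odot> q') \<odot> (i' \<odot> p) = mzero \<C> P P"
    using cmp_assoc[OF c(3) h(8) h(2)] cmp_assoc[OF h(3) h(5) h(8)] h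
      cmp_mzero_left[OF h(3) o(2)] cmp_mzero_right[OF h(2) o(3)] by simp
  also have "i \<odot> p \<boxplus> mzero \<C> P P = i \<odot> p" using madd_mzero_right[OF c(5)] .
  finally have 1: "((i \<odot> p') \<boxplus> (j \<odot> q')) \<odot> (i' \<odot> p) = i \<odot> p" .
  have "((i \<odot> p') \<boxplus> (j \<odot> q')) \<odot> (j' \<odot> q) = ((i \<odot> p') \<odot> (j' \<odot> q)) \<boxplus> ((j \<odot> q') \<odot> (j' \<odot> q))"
    using cmp_madd_left[OF c(4) c(1,2)] .
  also have "(i \<odot> p') \<odot> (j' \<odot> q) = mzero \<C> P P"
    using cmp_assoc[OF c(4) h(7) h(1)] cmp_assoc[OF h(4) h(6) h(7)] h
      cmp_mzero_left[OF h(4) o(1)] cmp_mzero_right[OF h(1) o(3)] by simp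
  also have "(j \<odot> q') \<odot> (j' \<odot> q) = j \<odot> q"
    using cmp_assoc[OF c(4) h(8) h(2)] cmp_assoc[OF h(4) h(6) h(8)] h cmp_idn_left by simp
  also have "mzero \<C> P P \<boxplus> j \<odot> q = j \<odot> q" using madd_mzero_left[OF c(6)] .
  finally have 2: "((i \<odot> p') \<boxplus> (j \<odot> q')) \<odot> (j' \<odot> q) = j \<odot> q" .
  show ?thesis using cmp_madd_right[OF c(3,4) s] 1 2 h by simp
qed

lemma biproduct_unique:
  assumes P: "biproduct \<C> A B P i j p q" and Q: "biproduct \<C> A B Q i' j' p' q'"
  shows "\<exists>b. isomorphism \<C> P Q b \<and> b \<odot> i = i' \<and> q' \<odot> b = q"
proof -
  have h: "i \<in> Hom \<C> A P" "j \<in> Hom \<C> B P" "p \<in> Hom \<C> P A" "q \<in> Hom \<C> P B"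
      "i' \<in> Hom \<C> A Q" "j' \<in> Hom \<C> B Q" "p' \<in> Hom \<C> Q A" "q' \<in> Hom \<C> Q B"
      "q' \<odot> j' = idn \<C> B" "q' \<odot> i' = mzero \<C> A B" "p \<odot> i = idn \<C> A" "q \<odot> i = mzero \<C> A B"
    using P Q by (auto simp: biproduct_def)
  have o: "A \<in> Obj \<C>" "B \<in> Obj \<C>" "P \<in> Obj \<C>" "Q \<in> Obj \<C>"
    using Hom_Obj[OF h(1)] Hom_Obj[OF h(6)] by simp_all
  have c: "i \<odot> p' \<in> Hom \<C> Q P" "j \<odot> q' \<in> Hom \<C> Q P" "i' \<odot> p \<in> Hom \<C> P Q" "j' \<odot> q \<in> Hom \<C> P Q"
    using cmp_Hom[OF h(7,1)] cmp_Hom[OF h(8,2)] cmp_Hom[OF h(3,5)] cmp_Hom[OF h(4,6)] by simp_all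
  let ?b = "(i' \<odot> p) \<boxplus> (j' \<odot> q)"
  have iso: "isomorphism \<C> P Q ?b"
    unfolding isomorphism_def
    using biproduct_matrix_cmp[OF P Q] biproduct_matrix_cmp[OF Q P] madd_closed[OF c(1,2)]
      madd_closed[OF c(3,4)] by auto
  have "?b \<odot> i = ((i' \<odot> p) \<odot> i) \<boxplus> ((j' \<odot> q) \<odot> i)" using cmp_madd_left[OF h(1) c(3,4)] .
  also have "\<dots> = i' \<boxplus> mzero \<C> A Q"
    using cmp_assoc[OF h(1,3,5)] cmp_assoc[OF h(1,4,6)] h cmp_idn_right
      cmp_mzero_right[OF h(6) o(1)] by simp
  finally have 1: "?b \<odot> i = i'" using madd_mzero_right h by simp
  have "q' \<odot> ?b = (q' \<odot> (i' \<odot> p)) \<boxplus> (q' \<odot> (j' \<odot> q))" using cmp_madd_right[OF c(3,4) h(8)] .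
  also have "\<dots> = mzero \<C> P B \<boxplus> q"
    using cmp_assoc[OF h(3,5,8)] cmp_assoc[OF h(4,6,8)] h cmp_idn_left
      cmp_mzero_left[OF h(3) o(2)] by simp
  finally have 2: "q' \<odot> ?b = q" using madd_mzero_left h by simp
  show ?thesis using iso 1 2 by blast
qed

end

section \<open>Equivalences are fully faithful\<close>

context additive_category
begin

context
  fixes F T assumes FT: "additive_endofunctor \<C> F T"
begin

lemma functor_Obj: "A \<in> Obj \<C> \<Longrightarrow> F A \<in> Obj \<C>"
  using FT by (simp add: additive_endofunctor_def)

lemma functor_idn: "A \<in> Obj \<C> \<Longrightarrow> T (idn \<C> A) = idn \<C> (F A)"
  using FT by (simp add: additive_endofunctor_def)

lemma functor_hom:
  assumes "A \<in> Obj \<C>" "B \<in> Obj \<C>"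
  shows "T \<in> hom (hom_group \<C> A B) (hom_group \<C> (F A) (F B))"
  by (rule FT[unfolded additive_endofunctor_def, THEN conjunct2, THEN conjunct1, rule_format, OF assms])

lemma functor_Hom:
  assumes "f \<in> Hom \<C> A B"
  shows "T f \<in> Hom \<C> (F A) (F B)"
proof -
  have "T \<in> hom (hom_group \<C> A B) (hom_group \<C> (F A) (F B))"
    using functor_hom Hom_Obj[OF assms] by blast
  from hom_in_carrier[OF this, of f] show ?thesis using assms by (simp add: hom_group_sel)
qed

lemma functor_cmp:
  assumes "f \<in> Hom \<C> A B" "g \<in> Hom \<C> B D"
  shows "T (g \<odot> f) = T g \<odot> T f"
proof -
  have "A \<in> Obj \<C>" "B \<in> Obj \<C>" "D \<in> Obj \<C>" using assms Hom_Obj by blast+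
  then show ?thesis using FT assms unfolding additive_endofunctor_def by blast
qed

lemma functor_group_hom:
  assumes "A \<in> Obj \<C>" "B \<in> Obj \<C>"
  shows "group_hom (hom_group \<C> A B) (hom_group \<C> (F A) (F B)) T"
  using group_hom.intro[OF comm_group.axioms(2)[OF hom_comm_group[OF assms]]
      comm_group.axioms(2)[OF hom_comm_group[OF functor_Obj[OF assms(1)] functor_Obj[OF assms(2)]]]
      group_hom_axioms.intro[OF functor_hom[OF assms]]] .

lemma functor_mzero:
  assumes "A \<in> Obj \<C>" "B \<in> Obj \<C>"
  shows "T (mzero \<C> A B) = mzero \<C> (F A) (F B)"
  using group_hom.hom_one[OF functor_group_hom[OF assms]] by (simp add: hom_group_sel)

lemma functor_zero_object:
  assumes "zero_object \<C> Z"
  shows "zero_object \<C> (F Z)"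
proof -
  have Z: "Z \<in> Obj \<C>" using assms by (simp add: zero_object_def)
  show ?thesis
    using zero_object_if_idn[OF functor_Obj[OF Z]] functor_idn[OF Z] functor_mzero[OF Z Z]
      zero_object_idn[OF assms] by simp
qed

end

lemma faithful_if_left_inverse:
  assumes FT: "additive_endofunctor \<C> F T" and GS: "additive_endofunctor \<C> G S"
    and t: "nat_iso_to_id \<C> (G \<circ> F) (S \<circ> T) t"
    and f: "f \<in> Hom \<C> A B" "f' \<in> Hom \<C> A B" and eq: "T f = T f'"
  shows "f = f'"
proof -
  have o: "A \<in> Obj \<C>" "B \<in> Obj \<C>" using f Hom_Obj by blast+
  have "t B \<odot> S (T f) = f \<odot> t A" "t B \<odot> S (T f') = f' \<odot> t A"
    using t o f by (simp_all add: nat_iso_to_id_def)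
  moreover have "isomorphism \<C> (G (F A)) A (t A)" using t o by (simp add: nat_iso_to_id_def)
  ultimately show ?thesis using iso_cancel_right f eq by metis
qed

text \<open>Fullness comes from faithfulness of the quasi-inverse: the preimage of \<open>h\<close> is forced to be
  the conjugate of \<open>S h\<close> by the natural isomorphism.\<close>

lemma full_if_equivalence:
  assumes FT: "additive_endofunctor \<C> F T" and GS: "additive_endofunctor \<C> G S"
    and t: "nat_iso_to_id \<C> (G \<circ> F) (S \<circ> T) t" and u: "nat_iso_to_id \<C> (F \<circ> G) (T \<circ> S) u"
    and o: "A \<in> Obj \<C>" "B \<in> Obj \<C>" and h: "h \<in> Hom \<C> (F A) (F B)"
  shows "\<exists>f\<in>Hom \<C> A B. T f = h"
proof -
  have tA: "isomorphism \<C> (G (F A)) A (t A)" and tB: "isomorphism \<C> (G (F B)) B (t B)"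
    using t o by (simp_all add: nat_iso_to_id_def)
  then obtain s where s: "s \<in> Hom \<C> A (G (F A))" "s \<odot> t A = idn \<C> (G (F A))" and
    tAH: "t A \<in> Hom \<C> (G (F A)) A" and tBH: "t B \<in> Hom \<C> (G (F B)) B"
    by (auto simp: isomorphism_def)
  have Sh: "S h \<in> Hom \<C> (G (F A)) (G (F B))" using functor_Hom[OF GS h] .
  have Shs: "S h \<odot> s \<in> Hom \<C> A (G (F B))" using s Sh cmp_Hom by blast
  define f where "f = t B \<odot> (S h \<odot> s)"
  have f: "f \<in> Hom \<C> A B" unfolding f_def using Shs tBH cmp_Hom by blast
  have Tf: "T f \<in> Hom \<C> (F A) (F B)" using functor_Hom[OF FT f] .
  have "t B \<odot> S (T f) = f \<odot> t A" using t o f by (simp add: nat_iso_to_id_def)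
  also have "\<dots> = t B \<odot> ((S h \<odot> s) \<odot> t A)" unfolding f_def using cmp_assoc[OF tAH Shs tBH] .
  also have "(S h \<odot> s) \<odot> t A = S h" using cmp_assoc[OF tAH s(1) Sh] s(2) cmp_idn_right[OF Sh] by simp
  finally have "S (T f) = S h" using iso_cancel_left[OF tB functor_Hom[OF GS Tf] Sh] by simp
  then have "T f = h" using faithful_if_left_inverse[OF GS FT u Tf h] by simp
  then show ?thesis using f by blast
qed

end

section \<open>Exactness in triangulated categories\<close>

context triangulated_category
begin

abbreviation "\<Sigma> \<equiv> susp \<C>"

abbreviation "\<Sigma>M \<equiv> suspM \<C>"

lemmas susp_Obj = functor_Obj[OF susp_functor]
lemmas suspM_Hom = functor_Hom[OF susp_functor]
lemmas suspM_cmp = functor_cmp[OF susp_functor]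
lemmas suspM_idn = functor_idn[OF susp_functor]
lemmas suspM_mzero = functor_mzero[OF susp_functor]
lemmas suspM_faithful = faithful_if_left_inverse[OF susp_functor desusp_functor desusp_susp_iso]
lemmas suspM_full =
  full_if_equivalence[OF susp_functor desusp_functor desusp_susp_iso susp_desusp_iso]
lemmas desuspM_Hom = functor_Hom[OF desusp_functor]
lemmas desuspM_cmp = functor_cmp[OF desusp_functor]
lemmas desuspM_mzero = functor_mzero[OF desusp_functor]
lemmas desuspM_faithful = faithful_if_left_inverse[OF desusp_functor susp_functor susp_desusp_iso]
lemmas desuspM_full =
  full_if_equivalence[OF desusp_functor susp_functor susp_desusp_iso desusp_susp_iso]

lemma triangle_Hom:
  assumes "triangle \<C> A B D f g h"
  shows "f \<in> Hom \<C> A B" "g \<in> Hom \<C> B D" "h \<in> Hom \<C> D (\<Sigma> A)"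
  using assms by (simp_all add: triangle_def candidate_def)

lemma triangle_Obj:
  assumes "triangle \<C> A B D f g h"
  shows "A \<in> Obj \<C>" "B \<in> Obj \<C>" "D \<in> Obj \<C>"
  using triangle_Hom[OF assms] Hom_Obj by blast+

lemma rotate:
  assumes "triangle \<C> A B D f g h"
  shows "triangle \<C> B D (\<Sigma> A) g h (neg (\<Sigma> A) (\<Sigma> B) (\<Sigma>M f))"
proof -
  have "candidate \<C> A B D f g h" using assms by (simp add: triangle_def)
  from TR2[OF this] show ?thesis using assms by blast
qed

text \<open>A triangle whose third object is a suspension rotates backwards: since \<open>[1]\<close> is full, its third
  morphism is, up to sign, the suspension of the missing first one.\<close>

lemma rotate_back:
  assumes t: "triangle \<C> B D (\<Sigma> A) g h k" and A: "A \<in> Obj \<C>"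
  shows "\<exists>f. triangle \<C> A B D f g h"
proof -
  have k: "k \<in> Hom \<C> (\<Sigma> A) (\<Sigma> B)" using triangle_Hom[OF t] by blast
  then have "neg (\<Sigma> A) (\<Sigma> B) k \<in> Hom \<C> (\<Sigma> A) (\<Sigma> B)" by (rule neg_Hom)
  then obtain f where f: "f \<in> Hom \<C> A B" "\<Sigma>M f = neg (\<Sigma> A) (\<Sigma> B) k"
    using suspM_full[OF A triangle_Obj(1)[OF t]] by blast
  have "candidate \<C> A B D f g h"
    using f triangle_Hom[OF t] by (simp add: candidate_def)
  moreover have "k = neg (\<Sigma> A) (\<Sigma> B) (\<Sigma>M f)" using neg_neg[OF k] f by simp
  ultimately show ?thesis using t TR2 by blast
qed

text \<open>Every object is isomorphic to a suspension, so the cone of \<open>g\<close> may be taken to be one.\<close>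

lemma cocone_exists:
  assumes g: "g \<in> Hom \<C> B D"
  shows "\<exists>A f h. triangle \<C> A B D f g h"
proof -
  obtain E u v where t: "triangle \<C> B D E g u v" using TR1_cone[OF g] by blast
  define A where "A = desusp \<C> E"
  have E: "E \<in> Obj \<C>" using triangle_Obj[OF t] by blast
  have A: "A \<in> Obj \<C>" unfolding A_def using functor_Obj[OF desusp_functor E] .
  have "isomorphism \<C> (\<Sigma> A) E (susp_desusp \<C> E)"
    using susp_desusp_iso E by (simp add: nat_iso_to_id_def A_def)
  then obtain s s' where s: "s \<in> Hom \<C> E (\<Sigma> A)" "s' \<in> Hom \<C> (\<Sigma> A) E" "s' \<odot> s = idn \<C> E" "s \<odot> s' = idn \<C> (\<Sigma> A)"
    by (auto simp: isomorphism_def)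
  then have si: "isomorphism \<C> E (\<Sigma> A) s" by (auto simp: isomorphism_def)
  have h: "g \<in> Hom \<C> B D" "u \<in> Hom \<C> D E" "v \<in> Hom \<C> E (\<Sigma> B)" using triangle_Hom[OF t] by blast+
  have o: "B \<in> Obj \<C>" "D \<in> Obj \<C>" using triangle_Obj[OF t] by blast+
  have "candidate \<C> B D (\<Sigma> A) g (s \<odot> u) (v \<odot> s')"
    using h s cmp_Hom unfolding candidate_def by blast
  moreover have "s \<odot> u = (s \<odot> u) \<odot> idn \<C> D" using cmp_idn_right[OF cmp_Hom[OF h(2) s(1)]] by simp
  moreover have "\<Sigma>M (idn \<C> B) \<odot> v = (v \<odot> s') \<odot> s"
    using suspM_idn[OF o(1)] cmp_idn_left[OF h(3)] cmp_assoc[OF s(1,2) h(3)] s(3) cmp_idn_right[OF h(3)]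
    by simp
  moreover have "idn \<C> D \<odot> g = g \<odot> idn \<C> B" using cmp_idn_left[OF g] cmp_idn_right[OF g] by simp
  ultimately have "triangle \<C> B D (\<Sigma> A) g (s \<odot> u) (v \<odot> s')"
    using TR_iso[OF t _ isomorphism_idn[OF o(1)] isomorphism_idn[OF o(2)] si] by blast
  then show ?thesis using rotate_back A by blast
qed

lemma triangle_cmp_mzero:
  assumes t: "triangle \<C> A B D f g h"
  shows "g \<odot> f = mzero \<C> A D"
proof -
  obtain Z where Z: "zero_object \<C> Z" using zero_object_exists by blast
  have h: "f \<in> Hom \<C> A B" "A \<in> Obj \<C>" "D \<in> Obj \<C>" using triangle_Hom[OF t] triangle_Obj[OF t] by blast+
  obtain d where d: "d \<in> Hom \<C> Z D" "d \<odot> mzero \<C> A Z = g \<odot> f"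
    using TR3[OF TR1_idn[OF h(2) Z] t idn_Hom[OF h(2)] h(1)] by auto
  then show ?thesis using cmp_mzero_right[OF d(1) h(2)] by simp
qed

text \<open>\<open>Hom(Y, -)\<close> is exact at the third object: a morphism killed by \<open>h\<close> is a map of the rotated
  triangle \<open>Y \<rightarrow> 0 \<rightarrow> Y[1]\<close> to \<open>D \<rightarrow> A[1] \<rightarrow> B[1]\<close>, and its third component desuspends to the lift.\<close>

lemma lift_through_second:
  assumes t: "triangle \<C> A B D f g h" and a: "a \<in> Hom \<C> Y D" and z: "h \<odot> a = mzero \<C> Y (\<Sigma> A)"
  shows "\<exists>b\<in>Hom \<C> Y B. g \<odot> b = a"
proof -
  obtain Z where Z: "zero_object \<C> Z" using zero_object_exists by blast
  have o: "A \<in> Obj \<C>" "B \<in> Obj \<C>" "Y \<in> Obj \<C>" "Z \<in> Obj \<C>"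
    using triangle_Obj[OF t] Hom_Obj[OF a] Z by (auto simp: zero_object_def)
  have g: "g \<in> Hom \<C> B D" using triangle_Hom[OF t] by blast
  have t1: "triangle \<C> Y Z (\<Sigma> Y) (mzero \<C> Y Z) (mzero \<C> Z (\<Sigma> Y)) (neg (\<Sigma> Y) (\<Sigma> Y) (idn \<C> (\<Sigma> Y)))"
    using rotate[OF TR1_idn[OF o(3) Z]] suspM_idn[OF o(3)] by simp
  have t2: "triangle \<C> D (\<Sigma> A) (\<Sigma> B) h (neg (\<Sigma> A) (\<Sigma> B) (\<Sigma>M f)) (neg (\<Sigma> B) (\<Sigma> D) (\<Sigma>M g))"
    using rotate[OF rotate[OF t]] .
  have m: "mzero \<C> Z (\<Sigma> A) \<in> Hom \<C> Z (\<Sigma> A)" using mzero_Hom o susp_Obj by blast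
  have "mzero \<C> Z (\<Sigma> A) \<odot> mzero \<C> Y Z = h \<odot> a"
    using z cmp_mzero_right[OF m o(3)] by simp
  from TR3[OF t1 t2 a m this] obtain d where d: "d \<in> Hom \<C> (\<Sigma> Y) (\<Sigma> B)"
      "\<Sigma>M a \<odot> neg (\<Sigma> Y) (\<Sigma> Y) (idn \<C> (\<Sigma> Y)) = neg (\<Sigma> B) (\<Sigma> D) (\<Sigma>M g) \<odot> d" by blast
  obtain b where b: "b \<in> Hom \<C> Y B" "\<Sigma>M b = d" using suspM_full[OF o(3,2) d(1)] by blast
  have Sa: "\<Sigma>M a \<in> Hom \<C> (\<Sigma> Y) (\<Sigma> D)" using suspM_Hom[OF a] .
  have Sg: "\<Sigma>M g \<in> Hom \<C> (\<Sigma> B) (\<Sigma> D)" using suspM_Hom[OF g] .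
  have gd: "\<Sigma>M g \<odot> d \<in> Hom \<C> (\<Sigma> Y) (\<Sigma> D)" using d(1) Sg cmp_Hom by blast
  have "neg (\<Sigma> Y) (\<Sigma> D) (\<Sigma>M a) = neg (\<Sigma> Y) (\<Sigma> D) (\<Sigma>M g \<odot> d)"
    using d(2) cmp_neg_right[OF idn_Hom[OF susp_Obj[OF o(3)]] Sa] cmp_idn_right[OF Sa]
      cmp_neg_left[OF d(1) Sg] by simp
  then have "\<Sigma>M a = \<Sigma>M g \<odot> d" using neg_neg[OF Sa] neg_neg[OF gd] by metis
  then have "\<Sigma>M (g \<odot> b) = \<Sigma>M a" using suspM_cmp[OF b(1) g] b(2) by simp
  then have "g \<odot> b = a" using suspM_faithful[OF cmp_Hom[OF b(1) g] a] by simp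
  then show ?thesis using b(1) by blast
qed

text \<open>Exactness at the second object is exactness at the third object of the twice rotated triangle.\<close>

lemma lift_through_first:
  assumes t: "triangle \<C> A B D f g h" and a: "a \<in> Hom \<C> Y B" and z: "g \<odot> a = mzero \<C> Y D"
  shows "\<exists>b\<in>Hom \<C> Y A. f \<odot> b = a"
proof -
  have f: "f \<in> Hom \<C> A B" and o: "A \<in> Obj \<C>" "B \<in> Obj \<C>" "Y \<in> Obj \<C>" "D \<in> Obj \<C>"
    and g: "g \<in> Hom \<C> B D"
    using triangle_Hom[OF t] triangle_Obj[OF t] Hom_Obj[OF a] by blast+
  have t2: "triangle \<C> D (\<Sigma> A) (\<Sigma> B) h (neg (\<Sigma> A) (\<Sigma> B) (\<Sigma>M f)) (neg (\<Sigma> B) (\<Sigma> D) (\<Sigma>M g))"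
    using rotate[OF rotate[OF t]] .
  have Sa: "\<Sigma>M a \<in> Hom \<C> (\<Sigma> Y) (\<Sigma> B)" using suspM_Hom[OF a] .
  have Sg: "\<Sigma>M g \<in> Hom \<C> (\<Sigma> B) (\<Sigma> D)" using suspM_Hom[OF g] .
  have Sf: "\<Sigma>M f \<in> Hom \<C> (\<Sigma> A) (\<Sigma> B)" using suspM_Hom[OF f] .
  have "neg (\<Sigma> B) (\<Sigma> D) (\<Sigma>M g) \<odot> \<Sigma>M a = mzero \<C> (\<Sigma> Y) (\<Sigma> D)"
    using cmp_neg_left[OF Sa Sg] suspM_cmp[OF a g, symmetric] z suspM_mzero[OF o(3,4)]
      neg_mzero[OF susp_Obj[OF o(3)] susp_Obj[OF o(4)]] by simp
  from lift_through_second[OF t2 Sa this] obtain c where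
    c: "c \<in> Hom \<C> (\<Sigma> Y) (\<Sigma> A)" "neg (\<Sigma> A) (\<Sigma> B) (\<Sigma>M f) \<odot> c = \<Sigma>M a" by blast
  have n: "neg (\<Sigma> Y) (\<Sigma> A) c \<in> Hom \<C> (\<Sigma> Y) (\<Sigma> A)" using neg_Hom[OF c(1)] .
  then obtain b where b: "b \<in> Hom \<C> Y A" "\<Sigma>M b = neg (\<Sigma> Y) (\<Sigma> A) c"
    using suspM_full[OF o(3,1)] by blast
  have "\<Sigma>M (f \<odot> b) = neg (\<Sigma> Y) (\<Sigma> B) (\<Sigma>M f \<odot> c)"
    using suspM_cmp[OF b(1) f] b(2) cmp_neg_right[OF c(1) Sf] by simp
  also have "\<dots> = \<Sigma>M a" using c(2) cmp_neg_left[OF c(1) Sf] by simp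
  finally have "f \<odot> b = a" using suspM_faithful[OF cmp_Hom[OF b(1) f] a] by simp
  then show ?thesis using b(1) by blast
qed

lemma triangle_zero_idn:
  assumes M: "M \<in> Obj \<C>" and Z: "zero_object \<C> Z"
  shows "\<exists>f. triangle \<C> Z M M f (idn \<C> M) (mzero \<C> M (\<Sigma> Z))"
  using rotate_back[OF TR1_idn[OF M functor_zero_object[OF susp_functor Z]]] Z
  by (simp add: zero_object_def)

text \<open>Dually, \<open>Hom(-, M)\<close> is exact at the second object: if \<open>x f = 0\<close>, then \<open>(0, x)\<close> completes to a map
  of triangles to \<open>0 \<rightarrow> M \<rightarrow> M\<close>, and its third component is the factorization.\<close>

lemma extend_through_third:
  assumes t: "triangle \<C> A B D f g h" and x: "x \<in> Hom \<C> B M" and z: "x \<odot> f = mzero \<C> A M"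
  shows "\<exists>y\<in>Hom \<C> D M. y \<odot> g = x"
proof -
  obtain Z where Z: "zero_object \<C> Z" using zero_object_exists by blast
  have o: "A \<in> Obj \<C>" "M \<in> Obj \<C>" "Z \<in> Obj \<C>"
    using triangle_Obj[OF t] Hom_Obj[OF x] Z by (auto simp: zero_object_def)
  obtain u where u: "triangle \<C> Z M M u (idn \<C> M) (mzero \<C> M (\<Sigma> Z))"
    using triangle_zero_idn[OF o(2) Z] by blast
  have m: "mzero \<C> A Z \<in> Hom \<C> A Z" using mzero_Hom o by blast
  have "x \<odot> f = u \<odot> mzero \<C> A Z" using z cmp_mzero_right[OF triangle_Hom(1)[OF u] o(1)] by simp
  from TR3[OF t u m x this] show ?thesis using cmp_idn_left[OF x] by auto
qed

section \<open>Split triangles\<close>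

text \<open>Since \<open>h = 0\<close>, the identity of \<open>D\<close> lifts to a section \<open>j\<close> of \<open>g\<close>.  The complementary idempotent
  \<open>e = 1 - j g\<close> is killed by \<open>g\<close>, hence factors as \<open>f p\<close>, and the equations for \<open>p\<close> hold after composing
  with the monomorphism \<open>f\<close>.\<close>

lemma split_triangle_biproduct:
  assumes t: "triangle \<C> A B D f g h" and h0: "h = mzero \<C> D (\<Sigma> A)"
  shows "\<exists>j p. biproduct \<C> A D B f j p g"
proof -
  have h: "f \<in> Hom \<C> A B" "g \<in> Hom \<C> B D" and o: "A \<in> Obj \<C>" "B \<in> Obj \<C>" "D \<in> Obj \<C>"
    using triangle_Hom[OF t] triangle_Obj[OF t] by blast+
  have mono: "b = b'" if b: "b \<in> Hom \<C> Y A" "b' \<in> Hom \<C> Y A" "f \<odot> b = f \<odot> b'" for Y b b'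
  proof -
    \<comment> \<open>The triangle \<open>D \<rightarrow> A[1] \<rightarrow> B[1]\<close> starts with the zero map, so the identity of \<open>A[1]\<close> extends to
      \<open>B[1]\<close>.  Thus \<open>f[1]\<close> is a split monomorphism, and \<open>f\<close> is monic because \<open>[1]\<close> is faithful.\<close>
    have t2: "triangle \<C> D (\<Sigma> A) (\<Sigma> B) h (neg (\<Sigma> A) (\<Sigma> B) (\<Sigma>M f)) (neg (\<Sigma> B) (\<Sigma> D) (\<Sigma>M g))"
      using rotate[OF rotate[OF t]] .
    have "idn \<C> (\<Sigma> A) \<odot> h = mzero \<C> D (\<Sigma> A)"
      using cmp_mzero_right[OF idn_Hom[OF susp_Obj[OF o(1)]] o(3)] h0 by simp
    then obtain y where y: "y \<in> Hom \<C> (\<Sigma> B) (\<Sigma> A)" "y \<odot> neg (\<Sigma> A) (\<Sigma> B) (\<Sigma>M f) = idn \<C> (\<Sigma> A)"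
      using extend_through_third[OF t2 idn_Hom[OF susp_Obj[OF o(1)]]] by blast
    have nf: "neg (\<Sigma> A) (\<Sigma> B) (\<Sigma>M f) \<in> Hom \<C> (\<Sigma> A) (\<Sigma> B)" using neg_Hom[OF suspM_Hom[OF h(1)]] .
    have "\<Sigma>M c = y \<odot> neg (\<Sigma> Y) (\<Sigma> B) (\<Sigma>M (f \<odot> c))" if c: "c \<in> Hom \<C> Y A" for c
    proof -
      have Sc: "\<Sigma>M c \<in> Hom \<C> (\<Sigma> Y) (\<Sigma> A)" using suspM_Hom[OF c] .
      have "neg (\<Sigma> Y) (\<Sigma> B) (\<Sigma>M (f \<odot> c)) = neg (\<Sigma> A) (\<Sigma> B) (\<Sigma>M f) \<odot> \<Sigma>M c"
        using cmp_neg_left[OF Sc suspM_Hom[OF h(1)]] suspM_cmp[OF c h(1)] by simp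
      then show ?thesis using cmp_assoc[OF Sc nf y(1)] y(2) cmp_idn_left[OF Sc] by simp
    qed
    then have "\<Sigma>M b = \<Sigma>M b'" using b by metis
    then show ?thesis using suspM_faithful b by blast
  qed
  have "h \<odot> idn \<C> D = mzero \<C> D (\<Sigma> A)" using cmp_idn_right[OF triangle_Hom(3)[OF t]] h0 by simp
  then obtain j where j: "j \<in> Hom \<C> D B" "g \<odot> j = idn \<C> D"
    using lift_through_second[OF t idn_Hom[OF o(3)]] by blast
  have jg: "j \<odot> g \<in> Hom \<C> B B" using j h cmp_Hom by blast
  have njg: "neg B B (j \<odot> g) \<in> Hom \<C> B B" using neg_Hom[OF jg] .
  define e where "e = idn \<C> B \<boxplus> neg B B (j \<odot> g)"
  have e: "e \<in> Hom \<C> B B" unfolding e_def using madd_closed[OF idn_Hom[OF o(2)] njg] .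
  have "g \<odot> (j \<odot> g) = g" using cmp_assoc[OF h(2) j(1) h(2)] j(2) cmp_idn_left[OF h(2)] by simp
  then have "g \<odot> e = mzero \<C> B D"
    unfolding e_def using cmp_madd_right[OF idn_Hom[OF o(2)] njg h(2)] cmp_idn_right[OF h(2)]
      cmp_neg_right[OF jg h(2)] madd_neg[OF h(2)] by simp
  then obtain p where p: "p \<in> Hom \<C> B A" "f \<odot> p = e" using lift_through_first[OF t e] by blast
  have gf: "g \<odot> f = mzero \<C> A D" using triangle_cmp_mzero[OF t] .
  have "e \<odot> f = f \<boxplus> neg A B ((j \<odot> g) \<odot> f)"
    unfolding e_def using cmp_madd_left[OF h(1) idn_Hom[OF o(2)] njg] cmp_idn_left[OF h(1)]
      cmp_neg_left[OF h(1) jg] by simp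
  also have "(j \<odot> g) \<odot> f = mzero \<C> A B"
    using cmp_assoc[OF h(1,2) j(1)] gf cmp_mzero_right[OF j(1) o(1)] by simp
  finally have ef: "e \<odot> f = f" using neg_mzero[OF o(1,2)] madd_mzero_right[OF h(1)] by simp
  have "e \<odot> j = j \<boxplus> neg D B ((j \<odot> g) \<odot> j)"
    unfolding e_def using cmp_madd_left[OF j(1) idn_Hom[OF o(2)] njg] cmp_idn_left[OF j(1)]
      cmp_neg_left[OF j(1) jg] by simp
  also have "(j \<odot> g) \<odot> j = j" using cmp_assoc[OF j(1) h(2) j(1)] j(2) cmp_idn_right[OF j(1)] by simp
  finally have ej: "e \<odot> j = mzero \<C> D B" using madd_neg[OF j(1)] by simp
  have "p \<odot> f = idn \<C> A"
    using mono[OF cmp_Hom[OF h(1) p(1)] idn_Hom[OF o(1)]] cmp_assoc[OF h(1) p(1) h(1)] p(2) ef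
      cmp_idn_right[OF h(1)] by simp
  moreover have "p \<odot> j = mzero \<C> D A"
    using mono[OF cmp_Hom[OF j(1) p(1)] mzero_Hom[OF o(3,1)]] cmp_assoc[OF j(1) p(1) h(1)] p(2) ej
      cmp_mzero_right[OF h(1) o(3)] by simp
  moreover have "f \<odot> p \<boxplus> j \<odot> g = idn \<C> B"
  proof -
    have "e \<boxplus> j \<odot> g = idn \<C> B \<boxplus> (neg B B (j \<odot> g) \<boxplus> j \<odot> g)"
      unfolding e_def
      using comm_group.axioms(2)[OF hom_comm_group[OF o(2,2)], THEN group.is_monoid, THEN monoid.m_assoc]
        idn_Hom[OF o(2)] njg jg by (simp add: hom_group_sel)
    then show ?thesis
      using p(2) madd_comm[OF njg jg] madd_neg[OF jg] madd_mzero_right[OF idn_Hom[OF o(2)]] by simp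
  qed
  ultimately show ?thesis unfolding biproduct_def using h j p gf by blast
qed

text \<open>The cocone of \<open>0 : B \<rightarrow> A[1]\<close> is a biproduct of \<open>A\<close> and \<open>B\<close>, and biproducts are unique.\<close>

lemma biproduct_triangle:
  assumes P: "biproduct \<C> A B P i j p q"
  shows "triangle \<C> A P B i q (mzero \<C> B (\<Sigma> A))"
proof -
  have h: "i \<in> Hom \<C> A P" "q \<in> Hom \<C> P B" using P by (auto simp: biproduct_def)
  have o: "A \<in> Obj \<C>" "P \<in> Obj \<C>" "B \<in> Obj \<C>" using h Hom_Obj by blast+
  have m: "mzero \<C> B (\<Sigma> A) \<in> Hom \<C> B (\<Sigma> A)" using mzero_Hom susp_Obj o by blast
  obtain Q q' w where t: "triangle \<C> Q B (\<Sigma> A) q' (mzero \<C> B (\<Sigma> A)) w" using cocone_exists[OF m] by blast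
  obtain i' where t': "triangle \<C> A Q B i' q' (mzero \<C> B (\<Sigma> A))"
    using rotate_back[OF t o(1)] by blast
  obtain j' p' where Q: "biproduct \<C> A B Q i' j' p' q'" using split_triangle_biproduct[OF t'] by blast
  obtain b where b: "isomorphism \<C> Q P b" "b \<odot> i' = i" "q \<odot> b = q'"
    using biproduct_unique[OF Q P] by blast
  have "candidate \<C> A P B i q (mzero \<C> B (\<Sigma> A))" using h m by (simp add: candidate_def)
  moreover have "b \<odot> i' = i \<odot> idn \<C> A" using b cmp_idn_right[OF h(1)] by simp
  moreover have "idn \<C> B \<odot> q' = q \<odot> b" using b cmp_idn_left[OF triangle_Hom(2)[OF t']] by simp
  moreover have "\<Sigma>M (idn \<C> A) \<odot> mzero \<C> B (\<Sigma> A) = mzero \<C> B (\<Sigma> A) \<odot> idn \<C> B"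
    using suspM_idn[OF o(1)] cmp_idn_left[OF m] cmp_idn_right[OF m] by simp
  ultimately show ?thesis
    using TR_iso[OF t' _ isomorphism_idn[OF o(1)] b(1) isomorphism_idn[OF o(3)]] by blast
qed

section \<open>The octahedral axiom, desuspended\<close>

text \<open>The octahedral axiom for the composite \<open>A \<rightarrow> B \<rightarrow> K[1]\<close>, rotated back so that no
  suspended object remains except as the target of a connecting morphism.  Read along the second
  triangle it says that the cocone of a composite \<open>X \<rightarrow> B \<rightarrow> D\<close> is an extension of the cocones;
  applied to a rotated first triangle it yields homotopy pullbacks.\<close>

lemma octahedron:
  assumes t: "triangle \<C> A B D f g h" and x: "triangle \<C> K X B k p r"
  shows "\<exists>L k' l m s. triangle \<C> K L A k' l (r \<odot> f) \<and> triangle \<C> L X D m (g \<odot> p) s"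
proof -
  have h: "f \<in> Hom \<C> A B" "g \<in> Hom \<C> B D" "p \<in> Hom \<C> X B" "r \<in> Hom \<C> B (\<Sigma> K)"
    using triangle_Hom[OF t] triangle_Hom[OF x] by blast+
  have K: "K \<in> Obj \<C>" using triangle_Obj[OF x] by blast
  obtain L l e where c: "triangle \<C> L A (\<Sigma> K) l (r \<odot> f) e"
    using cocone_exists[OF cmp_Hom[OF h(1,4)]] by blast
  obtain k' where k': "triangle \<C> K L A k' l (r \<odot> f)" using rotate_back[OF c K] by blast
  have L: "L \<in> Obj \<C>" using triangle_Obj[OF c] by blast
  obtain u v where uv: "triangle \<C> D (\<Sigma> L) (\<Sigma> X) u v (\<Sigma>M g \<odot> neg (\<Sigma> X) (\<Sigma> B) (\<Sigma>M p))"
    using TR4[OF t rotate[OF rotate[OF x]] rotate[OF c]] by blast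
  have "\<Sigma>M g \<odot> neg (\<Sigma> X) (\<Sigma> B) (\<Sigma>M p) = neg (\<Sigma> X) (\<Sigma> D) (\<Sigma>M (g \<odot> p))"
    using cmp_neg_right[OF suspM_Hom[OF h(3)] suspM_Hom[OF h(2)]] suspM_cmp[OF h(3,2)] by simp
  then have uv': "triangle \<C> D (\<Sigma> L) (\<Sigma> X) u v (neg (\<Sigma> X) (\<Sigma> D) (\<Sigma>M (g \<odot> p)))" using uv by simp
  have "candidate \<C> X D (\<Sigma> L) (g \<odot> p) u v"
    using triangle_Hom[OF uv] cmp_Hom[OF h(3,2)] by (simp add: candidate_def)
  from TR2[OF this] uv' have "triangle \<C> X D (\<Sigma> L) (g \<odot> p) u v" by blast
  then obtain m where "triangle \<C> L X D m (g \<odot> p) u" using rotate_back L by blast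
  with k' show ?thesis by blast
qed

text \<open>The homotopy pullback \<open>P\<close> of \<open>B \<rightarrow> D \<leftarrow> X\<close> is the cocone of \<open>B \<rightarrow> D \<rightarrow> K[1]\<close>; both triangles through
  it come from the octahedron over the rotated triangle \<open>B \<rightarrow> D \<rightarrow> A[1]\<close>.\<close>

lemma homotopy_pullback:
  assumes t: "triangle \<C> A B D f g h" and x: "triangle \<C> K X D k p r"
  shows "\<exists>P u u' v v'. triangle \<C> K P B u u' (r \<odot> g) \<and> triangle \<C> A P X v v' (h \<odot> p)"
proof -
  obtain P u u' m s where P: "triangle \<C> K P B u u' (r \<odot> g)" "triangle \<C> P X (\<Sigma> A) m (h \<odot> p) s"
    using octahedron[OF rotate[OF t] x] by blast
  obtain v where "triangle \<C> A P X v m (h \<odot> p)" using rotate_back[OF P(2)] triangle_Obj[OF t] by blast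
  with P(1) show ?thesis by blast
qed

end

section \<open>Conflations and ghost morphisms\<close>

locale rigid_approximating_subcategory = triangulated_category \<C> for \<C> (structure) +
  fixes \<XX> :: "'a set"
  assumes additive_subcategory_XX: "additive_subcategory \<C> \<XX>"
    and contravariantly_finite_XX: "contravariantly_finite \<C> \<XX>"
    and rigid_XX: "rigid \<C> \<XX>"
begin

lemma XX_Obj: "X \<in> \<XX> \<Longrightarrow> X \<in> Obj \<C>"
  using additive_subcategory_XX unfolding additive_subcategory_def subcategory_def
  by (elim conjE) (rule subsetD)

lemma zero_object_XX: "zero_object \<C> Z \<Longrightarrow> Z \<in> \<XX>"
  using additive_subcategory_XX unfolding additive_subcategory_def by blast

lemma direct_sum_XX: "X \<in> \<XX> \<Longrightarrow> Y \<in> \<XX> \<Longrightarrow> P \<in> Obj \<C> \<Longrightarrow> direct_sum \<C> X Y P \<Longrightarrow> P \<in> \<XX>"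
  using additive_subcategory_XX unfolding additive_subcategory_def by blast

lemma rigid_Hom:
  assumes "X \<in> \<XX>" "Y \<in> \<XX>" "f \<in> Hom \<C> X (\<Sigma> Y)"
  shows "f = mzero \<C> X (\<Sigma> Y)"
  using rigid_XX assms unfolding rigid_def by blast

lemma perp0_Hom:
  assumes "N \<in> perp0 \<C> \<XX>" "X \<in> \<XX>" "f \<in> Hom \<C> X N"
  shows "f = mzero \<C> X N"
  using assms unfolding perp0_def by blast

text \<open>Rigidity puts the cone of an approximation into \<open>\<XX>\<^sup>\<bottom>\<close>: every map from \<open>\<XX>\<close> to the cone
  lifts to \<open>A\<close>, because its composite into \<open>X[1]\<close> is zero, and then factors through the approximation.\<close>

lemma approximation_triangle:
  assumes "A \<in> Obj \<C>"
  obtains X N x y e where "X \<in> \<XX>" "N \<in> perp0 \<C> \<XX>" "triangle \<C> X A N x y e"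
proof -
  obtain X x where X: "X \<in> \<XX>" "x \<in> Hom \<C> X A"
    and ap: "\<And>Y g. Y \<in> \<XX> \<Longrightarrow> g \<in> Hom \<C> Y A \<Longrightarrow> \<exists>t\<in>Hom \<C> Y X. g = x \<odot> t"
    using contravariantly_finite_XX assms
    unfolding contravariantly_finite_def right_approximation_def by blast
  obtain N y e where t: "triangle \<C> X A N x y e" using TR1_cone[OF X(2)] by blast
  have h: "y \<in> Hom \<C> A N" "e \<in> Hom \<C> N (\<Sigma> X)" and N: "N \<in> Obj \<C>"
    using triangle_Hom[OF t] triangle_Obj[OF t] by blast+
  have "b = mzero \<C> Y N" if Y: "Y \<in> \<XX>" and b: "b \<in> Hom \<C> Y N" for Y b
  proof -
    have "e \<odot> b = mzero \<C> Y (\<Sigma> X)" using rigid_Hom[OF Y X(1) cmp_Hom[OF b h(2)]] .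
    then obtain c where c: "c \<in> Hom \<C> Y A" "y \<odot> c = b" using lift_through_second[OF t b] by blast
    obtain s where s: "s \<in> Hom \<C> Y X" "c = x \<odot> s" using ap[OF Y c(1)] by blast
    have "b = (y \<odot> x) \<odot> s" using c(2) s(2) cmp_assoc[OF s(1) X(2) h(1)] by simp
    then show ?thesis using triangle_cmp_mzero[OF t] cmp_mzero_left[OF s(1) N] by simp
  qed
  then have "N \<in> perp0 \<C> \<XX>"
    unfolding perp0_def using N XX_Obj mzero_Hom by blast
  with X(1) t that show ?thesis by blast
qed

definition ghost :: "'a \<Rightarrow> 'a \<Rightarrow> 'b \<Rightarrow> bool" where
  "ghost A B h \<longleftrightarrow> h \<in> Hom \<C> A B \<and> (\<forall>Y\<in>\<XX>. \<forall>a\<in>Hom \<C> Y A. h \<odot> a = mzero \<C> Y B)"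

lemma ghost_Hom: "ghost A B h \<Longrightarrow> h \<in> Hom \<C> A B"
  by (simp add: ghost_def)

lemma ghostD: "ghost A B h \<Longrightarrow> Y \<in> \<XX> \<Longrightarrow> a \<in> Hom \<C> Y A \<Longrightarrow> h \<odot> a = mzero \<C> Y B"
  unfolding ghost_def by blast

lemma ghost_mzero:
  assumes "A \<in> Obj \<C>" "B \<in> Obj \<C>"
  shows "ghost A B (mzero \<C> A B)"
  unfolding ghost_def using mzero_Hom[OF assms] cmp_mzero_left[OF _ assms(2)] by blast

lemma ghost_cmp_right:
  assumes h: "ghost A B h" and f: "f \<in> Hom \<C> D A"
  shows "ghost D B (h \<odot> f)"
  unfolding ghost_def
proof (intro conjI ballI)
  show "h \<odot> f \<in> Hom \<C> D B" using cmp_Hom[OF f ghost_Hom[OF h]] .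
  fix Y a assume Y: "Y \<in> \<XX>" and a: "a \<in> Hom \<C> Y D"
  show "h \<odot> f \<odot> a = mzero \<C> Y B"
    using cmp_assoc[OF a f ghost_Hom[OF h]] ghostD[OF h Y cmp_Hom[OF a f]] by simp
qed

lemma desusp_to_natural:
  assumes y: "y \<in> Hom \<C> A N" and w: "w \<in> Hom \<C> D (\<Sigma> A)"
  shows "y \<odot> desusp_to \<C> A w = desusp_susp \<C> N \<odot> desuspM \<C> (\<Sigma>M y \<odot> w)"
proof -
  have o: "A \<in> Obj \<C>" "N \<in> Obj \<C>" using y Hom_Obj by blast+
  have d: "desusp_susp \<C> A \<in> Hom \<C> (desusp \<C> (\<Sigma> A)) A" "desusp_susp \<C> N \<in> Hom \<C> (desusp \<C> (\<Sigma> N)) N"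
    and nat: "desusp_susp \<C> N \<odot> desuspM \<C> (\<Sigma>M y) = y \<odot> desusp_susp \<C> A"
    using desusp_susp_iso o y by (simp_all add: nat_iso_to_id_def isomorphism_def)
  have dw: "desuspM \<C> w \<in> Hom \<C> (desusp \<C> D) (desusp \<C> (\<Sigma> A))" using desuspM_Hom[OF w] .
  have "y \<odot> desusp_to \<C> A w = (desusp_susp \<C> N \<odot> desuspM \<C> (\<Sigma>M y)) \<odot> desuspM \<C> w"
    unfolding desusp_to_def nat using cmp_assoc[OF dw d(1) y] by simp
  also have "\<dots> = desusp_susp \<C> N \<odot> desuspM \<C> (\<Sigma>M y \<odot> w)"
    using cmp_assoc[OF dw desuspM_Hom[OF suspM_Hom[OF y]] d(2)] desuspM_cmp[OF w suspM_Hom[OF y]] by simp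
  finally show ?thesis .
qed

lemma Hom_desusp_perp0:
  assumes Y: "Y \<in> \<XX>" and W: "W \<in> desusp_subcategory \<C> (perp0 \<C> \<XX>)" and u: "u \<in> Hom \<C> (desusp \<C> Y) W"
  shows "u = mzero \<C> (desusp \<C> Y) W"
proof -
  obtain N s s' where N: "N \<in> perp0 \<C> \<XX>" and
    s: "s \<in> Hom \<C> (desusp \<C> N) W" "s' \<in> Hom \<C> W (desusp \<C> N)" "s \<odot> s' = idn \<C> W"
    using W by (auto simp: desusp_subcategory_def isomorphic_def isomorphism_def)
  have o: "Y \<in> Obj \<C>" "N \<in> Obj \<C>" using XX_Obj[OF Y] N by (auto simp: perp0_def)
  obtain b where b: "b \<in> Hom \<C> Y N" "desuspM \<C> b = s' \<odot> u"
    using desuspM_full[OF o cmp_Hom[OF u s(2)]] by blast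
  have "s' \<odot> u = mzero \<C> (desusp \<C> Y) (desusp \<C> N)"
    using b(2) perp0_Hom[OF N Y b(1)] desuspM_mzero[OF o] by simp
  then have "s \<odot> (s' \<odot> u) = mzero \<C> (desusp \<C> Y) W"
    using cmp_mzero_right[OF s(1)] Hom_Obj[OF u] by simp
  then show ?thesis using cmp_assoc[OF u s(2,1)] s(3) cmp_idn_left[OF u] by simp
qed

text \<open>Given the defining condition of the relative structure, test it on \<open>y : A \<rightarrow> N\<close> from an
  approximation triangle \<open>X \<rightarrow> A \<rightarrow> N\<close>: for \<open>a\<close> from \<open>\<XX>\<close> the composite \<open>y[1] h a\<close> vanishes, so \<open>h a\<close>
  factors through \<open>X[1]\<close>, and then it is zero by rigidity.  Conversely a morphism killed by \<open>\<XX>\<close>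
  factors through the cone of an approximation of its source, which lies in \<open>\<XX>\<^sup>\<bottom>\<close>.\<close>

lemma ER_iff_ghost: "h \<in> ER \<C> (perp0 \<C> \<XX>) D A \<longleftrightarrow> ghost D (\<Sigma> A) h" if A: "A \<in> Obj \<C>"
proof
  assume ER: "h \<in> ER \<C> (perp0 \<C> \<XX>) D A"
  then have h: "h \<in> Hom \<C> D (\<Sigma> A)" by (simp add: ER_def)
  obtain X N x y e where X: "X \<in> \<XX>" and N: "N \<in> perp0 \<C> \<XX>" and t: "triangle \<C> X A N x y e"
    using approximation_triangle[OF A] by blast
  have xy: "x \<in> Hom \<C> X A" "y \<in> Hom \<C> A N" and No: "N \<in> Obj \<C>"
    using triangle_Hom[OF t] triangle_Obj[OF t] by blast+
  have "y \<odot> desusp_to \<C> A h \<in> factor_ideal \<C> (desusp_subcategory \<C> (perp0 \<C> \<XX>)) (desusp \<C> D) N"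
    using ER N xy by (simp add: ER_def)
  then obtain W u v where W: "W \<in> desusp_subcategory \<C> (perp0 \<C> \<XX>)"
    and uv: "u \<in> Hom \<C> (desusp \<C> D) W" "v \<in> Hom \<C> W N" and fac: "y \<odot> desusp_to \<C> A h = v \<odot> u"
    unfolding factor_ideal_def by auto
  have iN: "isomorphism \<C> (desusp \<C> (\<Sigma> N)) N (desusp_susp \<C> N)"
    using desusp_susp_iso No by (simp add: nat_iso_to_id_def)
  then have dN: "desusp_susp \<C> N \<in> Hom \<C> (desusp \<C> (\<Sigma> N)) N" by (simp add: isomorphism_def)
  have Sy: "\<Sigma>M y \<in> Hom \<C> (\<Sigma> A) (\<Sigma> N)" using suspM_Hom[OF xy(2)] .
  have yh: "\<Sigma>M y \<odot> h \<in> Hom \<C> D (\<Sigma> N)" using cmp_Hom[OF h Sy] .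
  have "h \<odot> a = mzero \<C> Y (\<Sigma> A)" if Y: "Y \<in> \<XX>" and a: "a \<in> Hom \<C> Y D" for Y a
  proof -
    have Yo: "Y \<in> Obj \<C>" using XX_Obj[OF Y] .
    have da: "desuspM \<C> a \<in> Hom \<C> (desusp \<C> Y) (desusp \<C> D)" using desuspM_Hom[OF a] .
    have dz: "desuspM \<C> (mzero \<C> Y (\<Sigma> N)) = mzero \<C> (desusp \<C> Y) (desusp \<C> (\<Sigma> N))"
      using desuspM_mzero[OF Yo susp_Obj[OF No]] .
    have "desusp_susp \<C> N \<odot> desuspM \<C> ((\<Sigma>M y \<odot> h) \<odot> a) = (y \<odot> desusp_to \<C> A h) \<odot> desuspM \<C> a"
      using desuspM_cmp[OF a yh] cmp_assoc[OF da desuspM_Hom[OF yh] dN] desusp_to_natural[OF xy(2) h]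
      by simp
    also have "\<dots> = v \<odot> (u \<odot> desuspM \<C> a)" unfolding fac using cmp_assoc[OF da uv] .
    also have "u \<odot> desuspM \<C> a = mzero \<C> (desusp \<C> Y) W"
      using Hom_desusp_perp0[OF Y W cmp_Hom[OF da uv(1)]] .
    also have "v \<odot> mzero \<C> (desusp \<C> Y) W = desusp_susp \<C> N \<odot> desuspM \<C> (mzero \<C> Y (\<Sigma> N))"
      unfolding dz using cmp_mzero_right[OF uv(2)] cmp_mzero_right[OF dN] Hom_Obj[OF da] by simp
    finally have "desuspM \<C> ((\<Sigma>M y \<odot> h) \<odot> a) = desuspM \<C> (mzero \<C> Y (\<Sigma> N))"
      using iso_cancel_left[OF iN desuspM_Hom[OF cmp_Hom[OF a yh]]
          desuspM_Hom[OF mzero_Hom[OF Yo susp_Obj[OF No]]]] by simp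
    then have z: "(\<Sigma>M y \<odot> h) \<odot> a = mzero \<C> Y (\<Sigma> N)"
      using desuspM_faithful[OF cmp_Hom[OF a yh] mzero_Hom[OF Yo susp_Obj[OF No]]] by simp
    have ha: "h \<odot> a \<in> Hom \<C> Y (\<Sigma> A)" using cmp_Hom[OF a h] .
    have t2: "triangle \<C> N (\<Sigma> X) (\<Sigma> A) e (neg (\<Sigma> X) (\<Sigma> A) (\<Sigma>M x)) (neg (\<Sigma> A) (\<Sigma> N) (\<Sigma>M y))"
      using rotate[OF rotate[OF t]] .
    have "neg (\<Sigma> A) (\<Sigma> N) (\<Sigma>M y) \<odot> (h \<odot> a) = mzero \<C> Y (\<Sigma> N)"
      using cmp_neg_left[OF ha Sy] cmp_assoc[OF a h Sy] z neg_mzero[OF Yo susp_Obj[OF No]] by simp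
    then obtain c where c: "c \<in> Hom \<C> Y (\<Sigma> X)" "neg (\<Sigma> X) (\<Sigma> A) (\<Sigma>M x) \<odot> c = h \<odot> a"
      using lift_through_second[OF t2 ha] by blast
    show ?thesis
      using c(2) rigid_Hom[OF Y X c(1)] cmp_mzero_right[OF neg_Hom[OF suspM_Hom[OF xy(1)]] Yo] by simp
  qed
  then show "ghost D (\<Sigma> A) h" using h by (simp add: ghost_def)
next
  assume gh: "ghost D (\<Sigma> A) h"
  then have h: "h \<in> Hom \<C> D (\<Sigma> A)" by (rule ghost_Hom)
  then have D: "D \<in> Obj \<C>" using Hom_Obj by blast
  obtain X M x c e where X: "X \<in> \<XX>" and M: "M \<in> perp0 \<C> \<XX>" and t: "triangle \<C> X D M x c e"
    using approximation_triangle[OF D] by blast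
  have c: "c \<in> Hom \<C> D M" and Mo: "M \<in> Obj \<C>" using triangle_Hom[OF t] triangle_Obj[OF t] by blast+
  have "h \<odot> x = mzero \<C> X (\<Sigma> A)" using ghostD[OF gh X triangle_Hom(1)[OF t]] .
  then obtain h' where h': "h' \<in> Hom \<C> M (\<Sigma> A)" "h' \<odot> c = h"
    using extend_through_third[OF t h] by blast
  have "y \<odot> desusp_to \<C> A h \<in> factor_ideal \<C> (desusp_subcategory \<C> (perp0 \<C> \<XX>)) (desusp \<C> D) N"
    if "N \<in> perp0 \<C> \<XX>" and y: "y \<in> Hom \<C> A N" for N y
  proof -
    have N: "N \<in> Obj \<C>" using y Hom_Obj by blast
    have dN: "desusp_susp \<C> N \<in> Hom \<C> (desusp \<C> (\<Sigma> N)) N"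
      using desusp_susp_iso N by (simp add: nat_iso_to_id_def isomorphism_def)
    have Sy: "\<Sigma>M y \<in> Hom \<C> (\<Sigma> A) (\<Sigma> N)" using suspM_Hom[OF y] .
    have yh': "\<Sigma>M y \<odot> h' \<in> Hom \<C> M (\<Sigma> N)" using cmp_Hom[OF h'(1) Sy] .
    have "\<Sigma>M y \<odot> h = (\<Sigma>M y \<odot> h') \<odot> c" using cmp_assoc[OF c h'(1) Sy] h'(2) by simp
    then have eq: "y \<odot> desusp_to \<C> A h = (desusp_susp \<C> N \<odot> desuspM \<C> (\<Sigma>M y \<odot> h')) \<odot> desuspM \<C> c"
      using desusp_to_natural[OF y h] desuspM_cmp[OF c yh']
        cmp_assoc[OF desuspM_Hom[OF c] desuspM_Hom[OF yh'] dN] by simp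
    have dM: "desusp \<C> M \<in> Obj \<C>" using functor_Obj[OF desusp_functor Mo] .
    then have "desusp \<C> M \<in> desusp_subcategory \<C> (perp0 \<C> \<XX>)"
      unfolding desusp_subcategory_def isomorphic_def using M isomorphism_idn[OF dM] by blast
    then show ?thesis
      unfolding factor_ideal_def eq using desuspM_Hom[OF c] cmp_Hom[OF desuspM_Hom[OF yh'] dN] by blast
  qed
  then show "h \<in> ER \<C> (perp0 \<C> \<XX>) D A" using h by (simp add: ER_def)
qed

definition conflation :: "'a \<Rightarrow> 'a \<Rightarrow> 'a \<Rightarrow> bool" where
  "conflation A B D \<longleftrightarrow> (\<exists>f g h. triangle \<C> A B D f g h \<and> ghost D (\<Sigma> A) h)"

lemma conflationR_iff_conflation:
  "(\<exists>f g. conflationR \<C> (perp0 \<C> \<XX>) A B D f g) \<longleftrightarrow> conflation A B D"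
proof -
  have "(\<exists>h\<in>ER \<C> (perp0 \<C> \<XX>) D A. triangle \<C> A B D f g h)
      \<longleftrightarrow> (\<exists>h. triangle \<C> A B D f g h \<and> ghost D (\<Sigma> A) h)" for f g
    using ER_iff_ghost triangle_Obj by blast
  then show ?thesis unfolding conflationR_def conflation_def by blast
qed

lemma conflation_Obj:
  assumes "conflation A B D"
  shows "A \<in> Obj \<C>" "B \<in> Obj \<C>" "D \<in> Obj \<C>"
  using assms triangle_Obj unfolding conflation_def by blast+

text \<open>In a homotopy pullback the new connecting morphisms are the old ones precomposed with something,
  and ghosts form a right ideal.\<close>

lemma conflation_pullback:
  assumes "conflation A B D" "conflation K X D"
  obtains P where "conflation K P B" "conflation A P X"
proof -
  obtain f g h where t: "triangle \<C> A B D f g h" and h: "ghost D (\<Sigma> A) h"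
    using assms(1) conflation_def by blast
  obtain k p r where x: "triangle \<C> K X D k p r" and r: "ghost D (\<Sigma> K) r"
    using assms(2) conflation_def by blast
  obtain P u u' v v' where P: "triangle \<C> K P B u u' (r \<odot> g)" "triangle \<C> A P X v v' (h \<odot> p)"
    using homotopy_pullback[OF t x] by blast
  have "ghost B (\<Sigma> K) (r \<odot> g)" "ghost X (\<Sigma> A) (h \<odot> p)"
    using ghost_cmp_right[OF r triangle_Hom(2)[OF t]] ghost_cmp_right[OF h triangle_Hom(2)[OF x]] .
  with P that show ?thesis unfolding conflation_def by blast
qed

text \<open>Deflations compose.  The connecting morphism of the composite is a ghost because a map from
  \<open>\<XX>\<close> to the end term lifts first to \<open>B\<close> and then to \<open>X\<close>.\<close>

lemma conflation_compose:
  assumes "conflation A B D" "conflation K X B"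
  obtains L where "conflation K L A" "conflation L X D"
proof -
  obtain f g h where t: "triangle \<C> A B D f g h" and h: "ghost D (\<Sigma> A) h"
    using assms(1) conflation_def by blast
  obtain k p r where x: "triangle \<C> K X B k p r" and r: "ghost B (\<Sigma> K) r"
    using assms(2) conflation_def by blast
  obtain L k' l m s where L: "triangle \<C> K L A k' l (r \<odot> f)" "triangle \<C> L X D m (g \<odot> p) s"
    using octahedron[OF t x] by blast
  have s: "s \<in> Hom \<C> D (\<Sigma> L)" using triangle_Hom[OF L(2)] by blast
  have gp: "g \<in> Hom \<C> B D" "p \<in> Hom \<C> X B" using triangle_Hom[OF t] triangle_Hom[OF x] by blast+
  have "s \<odot> a = mzero \<C> Y (\<Sigma> L)" if Y: "Y \<in> \<XX>" and a: "a \<in> Hom \<C> Y D" for Y a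
  proof -
    obtain b where b: "b \<in> Hom \<C> Y B" "g \<odot> b = a"
      using lift_through_second[OF t a ghostD[OF h Y a]] by blast
    obtain c where c: "c \<in> Hom \<C> Y X" "p \<odot> c = b"
      using lift_through_second[OF x b(1) ghostD[OF r Y b(1)]] by blast
    have "a = (g \<odot> p) \<odot> c" using cmp_assoc[OF c(1) gp(2,1)] b c by simp
    then have "s \<odot> a = (s \<odot> (g \<odot> p)) \<odot> c" using cmp_assoc[OF c(1) cmp_Hom[OF gp(2,1)] s] by simp
    also have "s \<odot> (g \<odot> p) = mzero \<C> X (\<Sigma> L)" using triangle_cmp_mzero[OF rotate[OF L(2)]] .
    also have "mzero \<C> X (\<Sigma> L) \<odot> c = mzero \<C> Y (\<Sigma> L)"
      using cmp_mzero_left[OF c(1)] Hom_Obj[OF s] by blast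
    finally show ?thesis .
  qed
  then have "ghost D (\<Sigma> L) s" using s by (simp add: ghost_def)
  moreover have "ghost A (\<Sigma> K) (r \<odot> f)" using ghost_cmp_right[OF r triangle_Hom(1)[OF t]] .
  ultimately show ?thesis using that L unfolding conflation_def by blast
qed

lemma direct_sum_sym: "direct_sum \<C> A B P \<Longrightarrow> direct_sum \<C> B A P"
  unfolding direct_sum_def using biproduct_sym by blast

lemma direct_sum_conflation:
  assumes "direct_sum \<C> A B P"
  shows "conflation A P B"
proof -
  obtain i q where t: "triangle \<C> A P B i q (mzero \<C> B (\<Sigma> A))"
    using assms biproduct_triangle unfolding direct_sum_def by blast
  then show ?thesis
    unfolding conflation_def using ghost_mzero[OF _ susp_Obj] triangle_Obj[OF t] by blast
qed

text \<open>The objects of \<open>\<XX>\<close> are projective: the connecting morphism \<open>h\<close> kills \<open>id\<close>.\<close>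

lemma conflation_splits:
  assumes "conflation A B X" "X \<in> \<XX>"
  shows "direct_sum \<C> A X B"
proof -
  obtain f g h where t: "triangle \<C> A B X f g h" and h: "ghost X (\<Sigma> A) h"
    using assms(1) conflation_def by blast
  have "h = mzero \<C> X (\<Sigma> A)"
    using ghostD[OF h assms(2) idn_Hom[OF XX_Obj[OF assms(2)]]] cmp_idn_right[OF ghost_Hom[OF h]] by simp
  then show ?thesis using split_triangle_biproduct[OF t] unfolding direct_sum_def by blast
qed

lemma conflation_swap: "conflation A B X \<Longrightarrow> X \<in> \<XX> \<Longrightarrow> conflation X B A"
  using conflation_splits direct_sum_sym direct_sum_conflation by blast

text \<open>An isomorphism \<open>A \<cong> B\<close> thus gives a conflation \<open>0 \<rightarrow> A \<rightarrow> B\<close>, which makes every additive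
  invariant of conflations an isomorphism invariant.\<close>

lemma isomorphic_direct_sum_zero:
  assumes Z: "zero_object \<C> Z" and AB: "isomorphic \<C> A B"
  shows "direct_sum \<C> Z B A"
proof -
  obtain f g where f: "f \<in> Hom \<C> A B" and g: "g \<in> Hom \<C> B A" "g \<odot> f = idn \<C> A" "f \<odot> g = idn \<C> B"
    using AB by (auto simp: isomorphic_def isomorphism_def)
  have o: "A \<in> Obj \<C>" "B \<in> Obj \<C>" "Z \<in> Obj \<C>" using Hom_Obj[OF f] Z by (auto simp: zero_object_def)
  have m: "mzero \<C> Z A \<in> Hom \<C> Z A" "mzero \<C> A Z \<in> Hom \<C> A Z" using mzero_Hom o by blast+
  have "mzero \<C> Z A \<odot> mzero \<C> A Z \<boxplus> g \<odot> f = idn \<C> A"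
    using cmp_mzero_right[OF m(1) o(1)] g(2) madd_mzero_left[OF idn_Hom[OF o(1)]] by simp
  moreover have "mzero \<C> A Z \<odot> mzero \<C> Z A = idn \<C> Z"
    using cmp_mzero_right[OF m(2) o(3)] zero_object_idn[OF Z] by simp
  moreover have "mzero \<C> A Z \<odot> g = mzero \<C> B Z" "f \<odot> mzero \<C> Z A = mzero \<C> Z B"
    using cmp_mzero_left[OF g(1) o(3)] cmp_mzero_right[OF f o(3)] by blast+
  ultimately show ?thesis unfolding direct_sum_def biproduct_def using f g m by blast
qed

end

section \<open>Quotients of free abelian groups\<close>

lemma generate_free_Abelian_group_additive:
  assumes "R \<subseteq> carrier (free_Abelian_group S)"
  defines "H \<equiv> generate (free_Abelian_group S) R"
  shows "0 \<in> H" and "\<And>x y. x \<in> H \<Longrightarrow> y \<in> H \<Longrightarrow> x + y \<in> H" and "\<And>x y. x \<in> H \<Longrightarrow> y \<in> H \<Longrightarrow> x - y \<in> H"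
    and "H \<subseteq> carrier (free_Abelian_group S)"
proof -
  interpret H: subgroup H "free_Abelian_group S"
    unfolding H_def using group.generate_is_subgroup[OF group_free_Abelian_group assms(1)] .
  show "0 \<in> H" using H.one_closed by simp
  show "H \<subseteq> carrier (free_Abelian_group S)" using H.subset .
  show add: "x + y \<in> H" if "x \<in> H" "y \<in> H" for x y using H.m_closed[OF that] by simp
  have "- y \<in> H" if "y \<in> H" for y
    using H.m_inv_closed[OF that] H.mem_carrier[OF that] by simp
  then show "x - y \<in> H" if "x \<in> H" "y \<in> H" for x y using add[of x "- y"] that by simp
qed

lemma generate_normal_free_Abelian_group:
  assumes "R \<subseteq> carrier (free_Abelian_group S)"
  shows "generate (free_Abelian_group S) R \<lhd> free_Abelian_group S"
  using comm_group.subgroup_imp_normal[OF abelian_free_Abelian_group]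
    group.generate_is_subgroup[OF group_free_Abelian_group assms] by blast

lemma free_Abelian_group_quotient_hom:
  assumes R: "R \<subseteq> carrier (free_Abelian_group S)"
  shows "group_hom (free_Abelian_group S) (free_Abelian_group S Mod generate (free_Abelian_group S) R)
    (\<lambda>x. generate (free_Abelian_group S) R #>\<^bsub>free_Abelian_group S\<^esub> x)"
  using normal.r_coset_hom_Mod[OF generate_normal_free_Abelian_group[OF R]]
    group_free_Abelian_group comm_group.axioms(2)[OF comm_group_free_Abelian_group_Mod[OF R]]
  by (intro group_hom.intro group_hom_axioms.intro)

text \<open>Existence in the universal property of a group given by generators and relations;
  \<open>presented_group_hom_eq\<close> is uniqueness.  The map on generators is required to kill the relations
  through its extensions to the free group, so that no linear extension has to be written down.\<close>

lemma presented_group_universal: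
  assumes K: "comm_group K" and R: "R \<subseteq> carrier (free_Abelian_group S)" and v: "v ` S \<subseteq> carrier K"
    and kill: "\<forall>h\<in>hom (free_Abelian_group S) K. (\<forall>x\<in>S. h (frag_of x) = v x)
      \<longrightarrow> (\<forall>r\<in>R. h r = \<one>\<^bsub>K\<^esub>)"
  shows "\<exists>\<phi>\<in>hom (free_Abelian_group S Mod generate (free_Abelian_group S) R) K.
    \<forall>x\<in>S. \<phi> (generate (free_Abelian_group S) R #>\<^bsub>free_Abelian_group S\<^esub> frag_of x) = v x"
proof -
  let ?F = "free_Abelian_group S"
  obtain h where h: "h \<in> hom ?F K" "\<And>x. x \<in> S \<Longrightarrow> h (frag_of x) = v x"
    using comm_group.free_Abelian_group_universal[OF K v] by blast
  interpret h: group_hom ?F K h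
    using h(1) K by (intro group_hom.intro group_hom_axioms.intro) (auto simp: comm_group_def)
  have "\<forall>r\<in>R. h r = \<one>\<^bsub>K\<^esub>" using kill h by simp
  then have "R \<subseteq> kernel ?F K h" using R unfolding kernel_def by blast
  then have "generate ?F R \<subseteq> kernel ?F K h"
    using group.generate_subgroup_incl[OF group_free_Abelian_group _ h.subgroup_kernel] by blast
  then obtain \<phi> where \<phi>: "\<phi> \<in> hom (?F Mod generate ?F R) K"
      "\<And>x. x \<in> carrier ?F \<Longrightarrow> \<phi> (generate ?F R #>\<^bsub>?F\<^esub> x) = h x"
    using h.FactGroup_universal_kernel[OF generate_normal_free_Abelian_group[OF R]] by metis
  have "\<forall>x\<in>S. \<phi> (generate ?F R #>\<^bsub>?F\<^esub> frag_of x) = v x" using \<phi>(2) h(2) by simp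
  with \<phi>(1) show ?thesis by blast
qed

lemma free_Abelian_group_quotient_one:
  assumes R: "R \<subseteq> carrier (free_Abelian_group S)" and x: "x \<in> generate (free_Abelian_group S) R"
  shows "generate (free_Abelian_group S) R #>\<^bsub>free_Abelian_group S\<^esub> x
    = \<one>\<^bsub>free_Abelian_group S Mod generate (free_Abelian_group S) R\<^esub>"
  using subgroup.rcos_const[OF group.generate_is_subgroup[OF group_free_Abelian_group R]
      group_free_Abelian_group x] by (simp add: FactGroup_def)

lemma free_Abelian_group_hom_diff:
  assumes h: "group_hom (free_Abelian_group S) K h"
    and x: "x \<in> carrier (free_Abelian_group S)" "y \<in> carrier (free_Abelian_group S)"
  shows "h (x - y) = h x \<otimes>\<^bsub>K\<^esub> inv\<^bsub>K\<^esub> (h y)"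
  using group_hom.hom_mult[OF h, of x "- y"] group_hom.hom_inv[OF h, of y] x by simp

lemma free_Abelian_group_hom_add:
  assumes h: "group_hom (free_Abelian_group S) K h"
    and x: "x \<in> carrier (free_Abelian_group S)" "y \<in> carrier (free_Abelian_group S)"
  shows "h (x + y) = h x \<otimes>\<^bsub>K\<^esub> h y"
  using group_hom.hom_mult[OF h x] by simp

lemma free_Abelian_group_quotient_eq:
  assumes R: "R \<subseteq> carrier (free_Abelian_group S)"
    and x: "x \<in> carrier (free_Abelian_group S)" "y \<in> carrier (free_Abelian_group S)"
    and xy: "x - y \<in> generate (free_Abelian_group S) R"
  shows "generate (free_Abelian_group S) R #>\<^bsub>free_Abelian_group S\<^esub> x
    = generate (free_Abelian_group S) R #>\<^bsub>free_Abelian_group S\<^esub> y"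
proof -
  interpret \<pi>: group_hom "free_Abelian_group S" "free_Abelian_group S Mod generate (free_Abelian_group S) R"
    "\<lambda>x. generate (free_Abelian_group S) R #>\<^bsub>free_Abelian_group S\<^esub> x"
    using free_Abelian_group_quotient_hom[OF R] .
  have "x - y \<in> carrier (free_Abelian_group S)"
    using xy generate_free_Abelian_group_additive(4)[OF R] by blast
  from free_Abelian_group_hom_add[OF \<pi>.group_hom_axioms this x(2)] show ?thesis
    using free_Abelian_group_quotient_one[OF R xy] \<pi>.H.l_one[OF \<pi>.hom_closed[OF x(2)]] by simp
qed

lemma presented_group_hom_eq:
  assumes K: "group K" and R: "R \<subseteq> carrier (free_Abelian_group S)"
    and f: "f \<in> hom (free_Abelian_group S Mod generate (free_Abelian_group S) R) K"
    and g: "g \<in> hom (free_Abelian_group S Mod generate (free_Abelian_group S) R) K"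
    and eq: "\<And>x. x \<in> S \<Longrightarrow> f (generate (free_Abelian_group S) R #>\<^bsub>free_Abelian_group S\<^esub> frag_of x)
      = g (generate (free_Abelian_group S) R #>\<^bsub>free_Abelian_group S\<^esub> frag_of x)"
    and u: "u \<in> carrier (free_Abelian_group S Mod generate (free_Abelian_group S) R)"
  shows "f u = g u"
proof -
  let ?F = "free_Abelian_group S"
  let ?\<pi> = "\<lambda>x. generate ?F R #>\<^bsub>?F\<^esub> x"
  have \<pi>: "?\<pi> \<in> hom ?F (?F Mod generate ?F R)" using normal.r_coset_hom_Mod[OF generate_normal_free_Abelian_group[OF R]] .
  have hf: "group_hom ?F K (f \<circ> ?\<pi>)" and hg: "group_hom ?F K (g \<circ> ?\<pi>)"
    using hom_compose[OF \<pi> f] hom_compose[OF \<pi> g] K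
    by (auto intro!: group_hom.intro group_hom_axioms.intro)
  have "Poly_Mapping.keys x \<subseteq> S \<and> (f \<circ> ?\<pi>) x = (g \<circ> ?\<pi>) x" if "Poly_Mapping.keys x \<subseteq> S" for x
    using that
  proof (induction x rule: frag_induction)
    case zero
    show ?case using group_hom.hom_one[OF hf] group_hom.hom_one[OF hg] by simp
  next
    case (one x)
    then show ?case using eq by simp
  next
    case (diff a b)
    have k: "group_hom ?F K k \<Longrightarrow> k (a - b) = k a \<otimes>\<^bsub>K\<^esub> inv\<^bsub>K\<^esub> (k b)" for k
      using group_hom.hom_mult[of ?F K k a "- b"] group_hom.hom_inv[of ?F K k b] diff by simp
    show ?case using k[OF hf] k[OF hg] diff keys_diff[of a b] by auto
  qed
  moreover obtain x where "x \<in> carrier ?F" "u = ?\<pi> x"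
    using u by (auto simp: FactGroup_def RCOSETS_def)
  ultimately show ?thesis by simp
qed

section \<open>Euler characteristics of resolutions\<close>

context rigid_approximating_subcategory
begin

definition cl :: "'a \<Rightarrow> 'a set \<Rightarrow>\<^sub>0 int" where
  "cl A = frag_of (iso_class \<C> A)"

abbreviation "H \<equiv> K0sp_subgroup \<C> \<XX>"

lemma K0sp_relations_carrier: "K0sp_relations \<C> \<XX> \<subseteq> carrier (free_Abelian_group (iso_class \<C> ` \<XX>))"
proof
  fix r assume "r \<in> K0sp_relations \<C> \<XX>"
  then obtain P X Y where "P \<in> \<XX>" "X \<in> \<XX>" "Y \<in> \<XX>" and
    r: "r = frag_of (iso_class \<C> P) - (frag_of (iso_class \<C> X) + frag_of (iso_class \<C> Y))"
    unfolding K0sp_relations_def by auto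
  then show "r \<in> carrier (free_Abelian_group (iso_class \<C> ` \<XX>))"
    unfolding r carrier_free_Abelian_group_iff
    by (intro order_trans[OF keys_diff] Un_least order_trans[OF keys_add]) auto
qed

lemmas H_additive = generate_free_Abelian_group_additive[OF K0sp_relations_carrier, folded K0sp_subgroup_def]
lemmas H_zero = H_additive(1) and H_add = H_additive(2) and H_diff = H_additive(3) and H_carrier = H_additive(4)

lemma H_relation:
  assumes "X \<in> \<XX>" "Y \<in> \<XX>" "P \<in> \<XX>" "direct_sum \<C> X Y P"
  shows "cl P - (cl X + cl Y) \<in> H"
proof -
  have "cl P - (cl X + cl Y) \<in> K0sp_relations \<C> \<XX>"
    unfolding cl_def K0sp_relations_def using assms by blast
  then show ?thesis unfolding K0sp_subgroup_def by (rule generate.incl)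
qed

lemma cl_zero_object: "zero_object \<C> Z \<Longrightarrow> cl Z \<in> H"
proof -
  assume Z: "zero_object \<C> Z"
  then have o: "Z \<in> Obj \<C>" by (simp add: zero_object_def)
  have "direct_sum \<C> Z Z Z"
    using isomorphic_direct_sum_zero[OF Z] isomorphism_idn[OF o] unfolding isomorphic_def by blast
  then have "cl Z - (cl Z + cl Z) \<in> H" using H_relation zero_object_XX[OF Z] by blast
  from H_diff[OF H_zero this] show ?thesis by simp
qed

text \<open>\<open>euler n A g\<close> says that \<open>g\<close> represents, modulo the relations of the split Grothendieck
  group, the alternating sum of some resolution of \<open>A\<close> of length \<open>n\<close>.\<close>

primrec euler :: "nat \<Rightarrow> 'a \<Rightarrow> ('a set \<Rightarrow>\<^sub>0 int) \<Rightarrow> bool" where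
  "euler 0 A g \<longleftrightarrow> A \<in> \<XX> \<and> g - cl A \<in> H"
| "euler (Suc n) A g \<longleftrightarrow>
    (\<exists>K X k. X \<in> \<XX> \<and> conflation K X A \<and> euler n K k \<and> g - (cl X - k) \<in> H)"

lemma euler_SucI:
  "X \<in> \<XX> \<Longrightarrow> conflation K X A \<Longrightarrow> euler n K k \<Longrightarrow> g - (cl X - k) \<in> H \<Longrightarrow> euler (Suc n) A g"
  by auto

lemma euler_SucE:
  assumes "euler (Suc n) A g"
  obtains K X k where "X \<in> \<XX>" "conflation K X A" "euler n K k" "g - (cl X - k) \<in> H"
  using assms by auto

lemma euler_Obj: "euler n A g \<Longrightarrow> A \<in> Obj \<C>"
  by (cases n) (auto dest: XX_Obj conflation_Obj)

text \<open>A resolution is lengthened at its end by the conflation \<open>0 \<rightarrow> X \<rightarrow> X\<close>, so two resolutions may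
  always be compared at the same length.\<close>

lemma euler_Suc: "euler n A g \<Longrightarrow> euler (Suc n) A g"
proof (induction n arbitrary: A g)
  case 0
  then have A: "A \<in> \<XX>" "g - cl A \<in> H" by simp_all
  obtain Z where Z: "zero_object \<C> Z" using zero_object_exists by blast
  have "isomorphic \<C> A A" using isomorphism_idn[OF XX_Obj[OF A(1)]] unfolding isomorphic_def by blast
  then have c: "conflation Z A A" using direct_sum_conflation isomorphic_direct_sum_zero[OF Z] by blast
  have "euler 0 Z 0" using zero_object_XX[OF Z] H_diff[OF H_zero cl_zero_object[OF Z]] by simp
  from euler_SucI[OF A(1) c this] A(2) show ?case by simp
next
  case (Suc n)
  from Suc.prems obtain K X k where
    X: "X \<in> \<XX>" "conflation K X A" "euler n K k" "g - (cl X - k) \<in> H" by (rule euler_SucE)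
  show ?case using euler_SucI[OF X(1,2) Suc.IH[OF X(3)] X(4)] .
qed

lemma euler_mono: "euler n A g \<Longrightarrow> n \<le> m \<Longrightarrow> euler m A g"
  by (rotate_tac, induction m rule: dec_induct) (auto intro: euler_Suc simp del: euler.simps)

text \<open>Pulling the first step \<open>K\<^sub>1 \<rightarrow> X \<rightarrow> K\<close> of a resolution back along \<open>P \<rightarrow> K\<close> replaces \<open>X\<close> by an
  extension of \<open>X\<close> by \<open>Y\<close>; this splits, and the syzygy \<open>K\<^sub>1\<close> does not change.\<close>

lemma euler_extension_by_XX:
  assumes "euler n K k" "conflation Y P K" "Y \<in> \<XX>"
  shows "euler n P (cl Y + k)"
proof (cases n)
  case 0
  then have K: "K \<in> \<XX>" "k - cl K \<in> H" using assms(1) by simp_all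
  have s: "direct_sum \<C> Y K P" using conflation_splits[OF assms(2) K(1)] .
  have P: "P \<in> \<XX>" using direct_sum_XX[OF assms(3) K(1) conflation_Obj(2)[OF assms(2)] s] .
  from H_diff[OF K(2) H_relation[OF assms(3) K(1) P s]] have "cl Y + k - cl P \<in> H"
    by (simp add: algebra_simps)
  with P 0 show ?thesis by simp
next
  case (Suc m)
  with assms(1) obtain K1 X k1 where
    X: "X \<in> \<XX>" "conflation K1 X K" "euler m K1 k1" "k - (cl X - k1) \<in> H" using euler_SucE by blast
  obtain Q where Q: "conflation K1 Q P" "conflation Y Q X" using conflation_pullback[OF assms(2) X(2)] .
  have s: "direct_sum \<C> Y X Q" using conflation_splits[OF Q(2) X(1)] .
  have QX: "Q \<in> \<XX>" using direct_sum_XX[OF assms(3) X(1) conflation_Obj(2)[OF Q(2)] s] .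
  from H_diff[OF X(4) H_relation[OF assms(3) X(1) QX s]] have "cl Y + k - (cl Q - k1) \<in> H"
    by (simp add: algebra_simps)
  with euler_SucI[OF QX Q(1) X(3)] Suc show ?thesis by blast
qed

text \<open>Schanuel's argument: the pullback \<open>P\<close> of two first steps \<open>X \<rightarrow> A \<leftarrow> X'\<close> is an extension of \<open>X'\<close>
  by \<open>K\<close> and of \<open>X\<close> by \<open>K'\<close>.  Both split and can be turned around, so a resolution of either syzygy
  gives one of \<open>P\<close>, to which the induction hypothesis applies.\<close>

lemma euler_unique: "euler n A g \<Longrightarrow> euler n A g' \<Longrightarrow> g - g' \<in> H"
proof (induction n arbitrary: A g g')
  case 0
  then have "g - cl A \<in> H" "g' - cl A \<in> H" by simp_all
  from H_diff[OF this] show ?case by simp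
next
  case (Suc n)
  obtain K X k where X: "X \<in> \<XX>" "conflation K X A" "euler n K k" "g - (cl X - k) \<in> H"
    using Suc.prems(1) by (rule euler_SucE)
  obtain K' X' k' where X': "X' \<in> \<XX>" "conflation K' X' A" "euler n K' k'" "g' - (cl X' - k') \<in> H"
    using Suc.prems(2) by (rule euler_SucE)
  obtain P where P: "conflation K P X'" "conflation K' P X" using conflation_pullback[OF X'(2) X(2)] .
  have "euler n P (cl X' + k)" "euler n P (cl X + k')"
    using euler_extension_by_XX[OF X(3) conflation_swap[OF P(1) X'(1)] X'(1)]
      euler_extension_by_XX[OF X'(3) conflation_swap[OF P(2) X(1)] X(1)] .
  from H_diff[OF H_diff[OF X(4) X'(4)] Suc.IH[OF this]] show ?case by (simp add: algebra_simps)
qed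

lemma euler_unique': "euler n A g \<Longrightarrow> euler m A g' \<Longrightarrow> g - g' \<in> H"
  using euler_unique[of "max n m" A g g'] euler_mono[of n A g "max n m"] euler_mono[of m A g' "max n m"]
  by simp

text \<open>In the inductive step let \<open>K \<rightarrow> X \<rightarrow> D\<close> be the first step of the resolution of \<open>D\<close> and pull it
  back to \<open>K \<rightarrow> P \<rightarrow> B\<close>, where \<open>P\<close> is an extension of \<open>X\<close> by \<open>A\<close>.  If \<open>M \<rightarrow> Y \<rightarrow> P\<close> is the first step of
  a resolution of \<open>P\<close>, then \<open>Y \<rightarrow> P \<rightarrow> B\<close> is a first step for \<open>B\<close>, and its syzygy is an extension of
  \<open>K\<close> by \<open>M\<close>, both of which have shorter resolutions.\<close>

lemma euler_conflation:
  "conflation A B D \<Longrightarrow> euler n A a \<Longrightarrow> euler n D d \<Longrightarrow> euler n B (a + d)"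
proof (induction n arbitrary: A B D a d)
  case 0
  then have A: "A \<in> \<XX>" "a - cl A \<in> H" and D: "D \<in> \<XX>" "d - cl D \<in> H" by simp_all
  have s: "direct_sum \<C> A D B" using conflation_splits[OF "0.prems"(1) D(1)] .
  have B: "B \<in> \<XX>" using direct_sum_XX[OF A(1) D(1) conflation_Obj(2)[OF "0.prems"(1)] s] .
  from H_diff[OF H_add[OF A(2) D(2)] H_relation[OF A(1) D(1) B s]] B show ?case
    by (simp add: algebra_simps)
next
  case (Suc n)
  obtain K X k where X: "X \<in> \<XX>" "conflation K X D" "euler n K k" "d - (cl X - k) \<in> H"
    using Suc.prems(3) by (rule euler_SucE)
  obtain P where P: "conflation K P B" "conflation A P X"
    using conflation_pullback[OF Suc.prems(1) X(2)] .
  have "euler (Suc n) P (cl X + a)"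
    using euler_extension_by_XX[OF Suc.prems(2) conflation_swap[OF P(2) X(1)] X(1)] .
  then obtain M Y m where Y: "Y \<in> \<XX>" "conflation M Y P" "euler n M m" "cl X + a - (cl Y - m) \<in> H"
    by (rule euler_SucE)
  obtain L where L: "conflation M L K" "conflation L Y B" using conflation_compose[OF P(1) Y(2)] .
  have "euler n L (m + k)" using Suc.IH[OF L(1) Y(3) X(3)] .
  moreover from H_add[OF X(4) Y(4)] have "a + d - (cl Y - (m + k)) \<in> H" by (simp add: algebra_simps)
  ultimately show ?case using euler_SucI[OF Y(1) L(2)] by blast
qed

lemma euler_additive:
  assumes "conflation A B D" "euler l A a" "euler m B b" "euler n D d"
  shows "b - (a + d) \<in> H"
proof -
  have "euler (max l n) B (a + d)"
    using euler_conflation[OF assms(1)] euler_mono[OF assms(2)] euler_mono[OF assms(4)] by simp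
  from euler_unique'[OF assms(3) this] show ?thesis .
qed

lemma euler_isomorphic:
  assumes "isomorphic \<C> A B" "euler n A a" "euler m B b"
  shows "a - b \<in> H"
proof -
  obtain Z where Z: "zero_object \<C> Z" using zero_object_exists by blast
  have c: "conflation Z A B"
    using direct_sum_conflation[OF isomorphic_direct_sum_zero[OF Z assms(1)]] .
  have "euler 0 Z 0" using zero_object_XX[OF Z] H_diff[OF H_zero cl_zero_object[OF Z]] by simp
  from euler_additive[OF c this assms(2,3)] show ?thesis by simp
qed

lemma euler_alternating_sum:
  assumes "\<And>i. i \<le> m \<Longrightarrow> X i \<in> \<XX>" "K m = X m" "\<And>i. i < m \<Longrightarrow> conflation (K (Suc i)) (X i) (K i)"
  shows "euler m (K 0) (\<Sum>i\<le>m. frag_cmul ((-1) ^ i) (cl (X i)))"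
  using assms
proof (induction m arbitrary: X K)
  case 0
  then show ?case using H_zero by simp
next
  case (Suc m)
  have IH: "euler m (K (Suc 0)) (\<Sum>i\<le>m. frag_cmul ((-1) ^ i) (cl (X (Suc i))))"
    using Suc.IH[of "\<lambda>i. X (Suc i)" "\<lambda>i. K (Suc i)"] Suc.prems by simp
  have eq: "(\<Sum>i\<le>Suc m. frag_cmul ((-1) ^ i) (cl (X i)))
      = cl (X 0) - (\<Sum>i\<le>m. frag_cmul ((-1) ^ i) (cl (X (Suc i))))"
    unfolding sum.atMost_Suc_shift by (simp add: sum_negf flip: minus_frag_cmul)
  show ?case unfolding eq by (rule euler_SucI[of "X 0", OF _ _ IH]) (use Suc.prems(1,3) H_zero in simp_all)
qed

lemma resolutionR_euler:
  assumes "resolutionR \<C> (perp0 \<C> \<XX>) \<XX> A m X d"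
  shows "euler m A (\<Sum>i\<le>m. frag_cmul ((-1) ^ i) (cl (X i)))"
proof -
  obtain K f g where K: "K 0 = A" "K m = X m" and X: "\<forall>i\<le>m. X i \<in> \<XX>"
    and c: "\<forall>i<m. conflationR \<C> (perp0 \<C> \<XX>) (K (Suc i)) (X i) (K i) (f i) (g i)"
    using assms unfolding resolutionR_def by blast
  have "conflation (K (Suc i)) (X i) (K i)" if "i < m" for i
    using c that conflationR_iff_conflation by blast
  then show ?thesis using euler_alternating_sum[of m X K] K X by simp
qed

end

section \<open>The isomorphism of Grothendieck groups\<close>

locale finitely_resolved = rigid_approximating_subcategory +
  assumes resolved: "A \<in> Obj \<C> \<Longrightarrow> \<exists>n g. euler n A g"
begin

abbreviation "FX \<equiv> free_Abelian_group (iso_class \<C> ` \<XX>)"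
abbreviation "FO \<equiv> free_Abelian_group (iso_class \<C> ` Obj \<C>)"
abbreviation "\<N> \<equiv> perp0 \<C> \<XX>"
abbreviation "KX \<equiv> K0sp \<C> \<XX>"
abbreviation "KO \<equiv> K0R \<C> \<N>"
abbreviation "\<pi>X x \<equiv> H #>\<^bsub>FX\<^esub> x"
abbreviation "\<pi>O x \<equiv> K0R_subgroup \<C> \<N> #>\<^bsub>FO\<^esub> x"

lemma K0R_relations_carrier: "K0R_relations \<C> \<N> \<subseteq> carrier FO"
proof
  fix r assume "r \<in> K0R_relations \<C> \<N>"
  then obtain A B D where "conflation A B D" and
    r: "r = frag_of (iso_class \<C> A) - frag_of (iso_class \<C> B) + frag_of (iso_class \<C> D)"
    unfolding K0R_relations_def using conflationR_iff_conflation by blast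
  then have "A \<in> Obj \<C>" "B \<in> Obj \<C>" "D \<in> Obj \<C>" using conflation_Obj by blast+
  then show "r \<in> carrier FO"
    unfolding r carrier_free_Abelian_group_iff
    by (intro order_trans[OF keys_add] Un_least order_trans[OF keys_diff]) auto
qed

lemmas \<pi>X_hom = free_Abelian_group_quotient_hom[OF K0sp_relations_carrier, folded K0sp_subgroup_def, folded K0sp_def]
lemmas \<pi>X_one = free_Abelian_group_quotient_one[OF K0sp_relations_carrier, folded K0sp_subgroup_def, folded K0sp_def]
lemmas \<pi>X_eq = free_Abelian_group_quotient_eq[OF K0sp_relations_carrier, folded K0sp_subgroup_def, folded K0sp_def]
lemmas \<pi>O_hom = free_Abelian_group_quotient_hom[OF K0R_relations_carrier, folded K0R_subgroup_def, folded K0R_def]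
lemmas \<pi>O_one = free_Abelian_group_quotient_one[OF K0R_relations_carrier, folded K0R_subgroup_def, folded K0R_def]
lemmas \<pi>O_eq = free_Abelian_group_quotient_eq[OF K0R_relations_carrier, folded K0R_subgroup_def, folded K0R_def]

lemma cl_FO: "A \<in> Obj \<C> \<Longrightarrow> cl A \<in> carrier FO"
  by (simp add: cl_def)

lemma cl_FX: "X \<in> \<XX> \<Longrightarrow> cl X \<in> carrier FX"
  by (simp add: cl_def)

lemma conflation_relation:
  assumes "conflation A B D"
  shows "cl A - cl B + cl D \<in> K0R_subgroup \<C> \<N>"
proof -
  have "cl A - cl B + cl D \<in> K0R_relations \<C> \<N>"
    unfolding cl_def K0R_relations_def using assms conflationR_iff_conflation by blast
  then show ?thesis unfolding K0R_subgroup_def by (rule generate.incl)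
qed

lemma carrier_FX_diff: "x \<in> carrier FX \<Longrightarrow> y \<in> carrier FX \<Longrightarrow> x - y \<in> carrier FX"
  using keys_diff[of x y] by auto

lemma carrier_FX_add: "x \<in> carrier FX \<Longrightarrow> y \<in> carrier FX \<Longrightarrow> x + y \<in> carrier FX"
  using Poly_Mapping.keys_add[of x y] by auto

lemma euler_carrier: "euler n A g \<Longrightarrow> g \<in> carrier FX"
proof (induction n arbitrary: A g)
  case 0
  then have A: "A \<in> \<XX>" "g - cl A \<in> H" by simp_all
  from carrier_FX_add[OF subsetD[OF H_carrier A(2)] cl_FX[OF A(1)]] show ?case by simp
next
  case (Suc n)
  obtain K X k where X: "X \<in> \<XX>" "euler n K k" "g - (cl X - k) \<in> H"
    using Suc.prems by (rule euler_SucE)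
  have "g - (cl X - k) \<in> carrier FX" using X(3) H_carrier by blast
  from carrier_FX_add[OF this carrier_FX_diff[OF cl_FX[OF X(1)] Suc.IH[OF X(2)]]] show ?case by simp
qed

text \<open>The candidate map on generators.  By uniqueness of Euler characteristics and their invariance
  under isomorphism, the choices of \<open>A\<close> and \<open>g\<close> do not matter.\<close>

definition index :: "'a set \<Rightarrow> ('a set \<Rightarrow>\<^sub>0 int) set" where
  "index c = \<pi>X (SOME g. \<exists>A n. A \<in> Obj \<C> \<and> iso_class \<C> A = c \<and> euler n A g)"

lemma index_eq:
  assumes "euler n A g"
  shows "index (iso_class \<C> A) = \<pi>X g"
proof -
  have A: "A \<in> Obj \<C>" using euler_Obj[OF assms] .
  let ?P = "\<lambda>g. \<exists>B n. B \<in> Obj \<C> \<and> iso_class \<C> B = iso_class \<C> A \<and> euler n B g"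
  have "?P (Eps ?P)" using A assms by (intro someI[of ?P g]) blast
  then obtain B m where B: "B \<in> Obj \<C>" "iso_class \<C> B = iso_class \<C> A" "euler m B (Eps ?P)" by blast
  have "isomorphic \<C> B A" using B(2) iso_class_eq_iff[OF B(1) A] by blast
  from euler_isomorphic[OF this B(3) assms] show ?thesis
    unfolding index_def using \<pi>X_eq euler_carrier[OF B(3)] euler_carrier[OF assms] by blast
qed

lemma index_XX: "X \<in> \<XX> \<Longrightarrow> index (iso_class \<C> X) = \<pi>X (cl X)"
  using index_eq[of 0 X "cl X"] H_zero by simp

text \<open>The relations of the relative Grothendieck group are respected by additivity of Euler
  characteristics on conflations.\<close>

lemma index_hom_exists:
  obtains \<phi> where "\<phi> \<in> hom KO KX" "\<And>A. A \<in> Obj \<C> \<Longrightarrow> \<phi> (\<pi>O (cl A)) = index (iso_class \<C> A)"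
proof -
  have v: "index ` iso_class \<C> ` Obj \<C> \<subseteq> carrier KX"
  proof clarsimp
    fix A assume "A \<in> Obj \<C>"
    then obtain n g where g: "euler n A g" using resolved by blast
    show "index (iso_class \<C> A) \<in> carrier KX"
      using index_eq[OF g] group_hom.hom_closed[OF \<pi>X_hom euler_carrier[OF g]] by simp
  qed
  have "h r = \<one>\<^bsub>KX\<^esub>"
    if h: "h \<in> hom FO KX" "\<forall>c\<in>iso_class \<C> ` Obj \<C>. h (frag_of c) = index c"
      and r: "r \<in> K0R_relations \<C> \<N>" for h r
  proof -
    obtain A B D where c: "conflation A B D" and r: "r = cl A - cl B + cl D"
      using r unfolding K0R_relations_def cl_def using conflationR_iff_conflation by blast
    have o: "A \<in> Obj \<C>" "B \<in> Obj \<C>" "D \<in> Obj \<C>" using conflation_Obj[OF c] .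
    obtain l m n a b d where e: "euler l A a" "euler m B b" "euler n D d" using resolved o by metis
    have F: "a \<in> carrier FX" "b \<in> carrier FX" "d \<in> carrier FX" using euler_carrier e by blast+
    have hh: "group_hom FO KX h"
      using h(1) comm_group.axioms(2)[OF comm_group_K0sp] group_free_Abelian_group
      by (intro group_hom.intro group_hom_axioms.intro)
    have hc: "h (cl A) = \<pi>X a" "h (cl B) = \<pi>X b" "h (cl D) = \<pi>X d"
      using h(2) o index_eq[OF e(1)] index_eq[OF e(2)] index_eq[OF e(3)] by (simp_all add: cl_def)
    have "cl A - cl B \<in> carrier FO" using cl_FO[OF o(1)] cl_FO[OF o(2)] keys_diff[of "cl A" "cl B"] by auto
    then have "h r = \<pi>X a \<otimes>\<^bsub>KX\<^esub> inv\<^bsub>KX\<^esub> (\<pi>X b) \<otimes>\<^bsub>KX\<^esub> \<pi>X d"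
      unfolding r using free_Abelian_group_hom_add[OF hh _ cl_FO[OF o(3)]]
        free_Abelian_group_hom_diff[OF hh cl_FO[OF o(1)] cl_FO[OF o(2)]] hc by simp
    also have "\<dots> = \<pi>X (a - b + d)"
      using free_Abelian_group_hom_add[OF \<pi>X_hom carrier_FX_diff[OF F(1,2)] F(3)]
        free_Abelian_group_hom_diff[OF \<pi>X_hom F(1,2)] by simp
    also have "a - b + d = 0 - (b - (a + d))" by simp
    also have "\<pi>X \<dots> = \<one>\<^bsub>KX\<^esub>" using \<pi>X_one H_diff[OF H_zero euler_additive[OF c e]] by blast
    finally show ?thesis .
  qed
  then have kill: "\<forall>h\<in>hom FO KX. (\<forall>c\<in>iso_class \<C> ` Obj \<C>. h (frag_of c) = index c)
      \<longrightarrow> (\<forall>r\<in>K0R_relations \<C> \<N>. h r = \<one>\<^bsub>KX\<^esub>)" by blast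
  from presented_group_universal[OF comm_group_K0sp K0R_relations_carrier v kill,
      folded K0R_subgroup_def, folded K0R_def]
  show ?thesis using that by (auto simp: cl_def)
qed

text \<open>The relations of the split group hold in the relative one because direct sums are conflations,
  with zero connecting morphism.\<close>

lemma inclusion_hom_exists:
  obtains \<psi> where "\<psi> \<in> hom KX KO" "\<And>X. X \<in> \<XX> \<Longrightarrow> \<psi> (\<pi>X (cl X)) = \<pi>O (cl X)"
proof -
  have v: "(\<lambda>c. \<pi>O (frag_of c)) ` iso_class \<C> ` \<XX> \<subseteq> carrier KO"
    using group_hom.hom_closed[OF \<pi>O_hom] XX_Obj by auto
  have "h r = \<one>\<^bsub>KO\<^esub>"
    if h: "h \<in> hom FX KO" "\<forall>c\<in>iso_class \<C> ` \<XX>. h (frag_of c) = \<pi>O (frag_of c)"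
      and r: "r \<in> K0sp_relations \<C> \<XX>" for h r
  proof -
    obtain P X Y where X: "P \<in> \<XX>" "X \<in> \<XX>" "Y \<in> \<XX>" "direct_sum \<C> X Y P" and r: "r = cl P - (cl X + cl Y)"
      using r unfolding K0sp_relations_def cl_def by blast
    have hh: "group_hom FX KO h"
      using h(1) comm_group.axioms(2)[OF comm_group_K0R] group_free_Abelian_group
      by (intro group_hom.intro group_hom_axioms.intro)
    have hc: "h (cl X) = \<pi>O (cl X)" if "X \<in> \<XX>" for X using h(2) that by (simp add: cl_def)
    have FXs: "cl P \<in> carrier FX" "cl X \<in> carrier FX" "cl Y \<in> carrier FX" using X cl_FX by blast+
    have FOs: "cl P \<in> carrier FO" "cl X \<in> carrier FO" "cl Y \<in> carrier FO" using X cl_FO XX_Obj by blast+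
    have s: "cl X + cl Y \<in> carrier FO" using FOs Poly_Mapping.keys_add[of "cl X" "cl Y"] by auto
    have "h r = \<pi>O r"
      unfolding r
      using free_Abelian_group_hom_diff[OF hh FXs(1) carrier_FX_add[OF FXs(2,3)]]
        free_Abelian_group_hom_add[OF hh FXs(2,3)] free_Abelian_group_hom_diff[OF \<pi>O_hom FOs(1) s]
        free_Abelian_group_hom_add[OF \<pi>O_hom FOs(2,3)] hc X by simp
    moreover have "0 - (cl X - cl P + cl Y) \<in> K0R_subgroup \<C> \<N>"
      using generate_free_Abelian_group_additive(1,3)[OF K0R_relations_carrier, folded K0R_subgroup_def]
        conflation_relation[OF direct_sum_conflation[OF X(4)]] by metis
    then have "\<pi>O r = \<one>\<^bsub>KO\<^esub>" unfolding r using \<pi>O_one by (simp add: algebra_simps)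
    ultimately show ?thesis by simp
  qed
  then have kill: "\<forall>h\<in>hom FX KO. (\<forall>c\<in>iso_class \<C> ` \<XX>. h (frag_of c) = \<pi>O (frag_of c))
      \<longrightarrow> (\<forall>r\<in>K0sp_relations \<C> \<XX>. h r = \<one>\<^bsub>KO\<^esub>)" by blast
  from presented_group_universal[OF comm_group_K0R K0sp_relations_carrier v kill,
      folded K0sp_subgroup_def, folded K0sp_def]
  show ?thesis using that by (auto simp: cl_def)
qed

text \<open>A conflation \<open>K \<rightarrow> X \<rightarrow> A\<close> expresses \<open>[A]\<close> as \<open>[X] - [K]\<close>, so along a resolution the class of \<open>A\<close>
  in the relative Grothendieck group becomes the alternating sum.\<close>

lemma inclusion_hom_euler:
  assumes \<psi>: "\<psi> \<in> hom KX KO" "\<And>X. X \<in> \<XX> \<Longrightarrow> \<psi> (\<pi>X (cl X)) = \<pi>O (cl X)"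
  shows "euler n A g \<Longrightarrow> \<psi> (\<pi>X g) = \<pi>O (cl A)"
proof (induction n arbitrary: A g)
  case 0
  then have A: "A \<in> \<XX>" "g - cl A \<in> H" by simp_all
  have "\<pi>X g = \<pi>X (cl A)" using \<pi>X_eq[OF euler_carrier[OF 0] cl_FX[OF A(1)] A(2)] .
  then show ?case using \<psi>(2)[OF A(1)] by simp
next
  case (Suc n)
  obtain K X k where X: "X \<in> \<XX>" "conflation K X A" "euler n K k" "g - (cl X - k) \<in> H"
    using Suc.prems by (rule euler_SucE)
  have o: "K \<in> Obj \<C>" "A \<in> Obj \<C>" "X \<in> Obj \<C>" using conflation_Obj[OF X(2)] by blast+
  have F: "cl X \<in> carrier FX" "k \<in> carrier FX" using cl_FX[OF X(1)] euler_carrier[OF X(3)] .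
  have hh: "group_hom FX KO (\<lambda>x. \<psi> (\<pi>X x))"
    using hom_compose[OF group_hom.homh[OF \<pi>X_hom] \<psi>(1)] comm_group.axioms(2)[OF comm_group_K0R]
      group_free_Abelian_group
    by (intro group_hom.intro group_hom_axioms.intro) (simp_all add: comp_def)
  have "\<psi> (\<pi>X g) = \<psi> (\<pi>X (cl X - k))"
    using \<pi>X_eq[OF euler_carrier[OF Suc.prems] carrier_FX_diff[OF F] X(4)] by simp
  also have "\<dots> = \<pi>O (cl X) \<otimes>\<^bsub>KO\<^esub> inv\<^bsub>KO\<^esub> (\<pi>O (cl K))"
    using free_Abelian_group_hom_diff[OF hh F] \<psi>(2)[OF X(1)] Suc.IH[OF X(3)] by simp
  also have "\<dots> = \<pi>O (cl X - cl K)"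
    using free_Abelian_group_hom_diff[OF \<pi>O_hom cl_FO[OF o(3)] cl_FO[OF o(1)]] by simp
  also have "\<dots> = \<pi>O (cl A)"
  proof -
    have d: "cl X - cl K \<in> carrier FO" using cl_FO[OF o(1)] cl_FO[OF o(3)] keys_diff[of "cl X" "cl K"] by auto
    have "cl A - (cl X - cl K) \<in> K0R_subgroup \<C> \<N>"
      using conflation_relation[OF X(2)] by (simp add: algebra_simps)
    from \<pi>O_eq[OF cl_FO[OF o(2)] d this] show ?thesis by simp
  qed
  finally show ?case .
qed

lemma \<pi>X_sum:
  fixes m :: nat
  assumes "\<And>i. i \<le> m \<Longrightarrow> X i \<in> \<XX>"
  shows "\<pi>X (\<Sum>i\<le>m. frag_cmul (c i) (cl (X i))) = (\<Otimes>\<^bsub>KX\<^esub>i\<in>{..m}. \<pi>X (cl (X i)) [^]\<^bsub>KX\<^esub> (c i :: int))"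
proof -
  interpret KX: comm_group KX by (rule comm_group_K0sp)
  interpret \<pi>: group_hom FX KX "\<lambda>x. \<pi>X x" by (rule \<pi>X_hom)
  have F: "frag_cmul (c i) (cl (X i)) \<in> carrier FX" if "i \<le> m" for i
    using keys_cmul[of "c i" "cl (X i)"] cl_FX[OF assms[OF that]] by auto
  have p: "\<pi>X (frag_cmul (c i) (cl (X i))) = \<pi>X (cl (X i)) [^]\<^bsub>KX\<^esub> c i" if "i \<le> m" for i
    using \<pi>.hom_int_pow[OF cl_FX[OF assms[OF that]], of "c i"] cl_FX[OF assms[OF that]] by simp
  have k: "\<pi>X (cl (X i)) [^]\<^bsub>KX\<^esub> c i \<in> carrier KX" if "i \<le> m" for i
    using \<pi>.hom_closed[OF cl_FX[OF assms[OF that]]] by simp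
  have "n \<le> m \<Longrightarrow> (\<Sum>i\<le>n. frag_cmul (c i) (cl (X i))) \<in> carrier FX \<and>
      \<pi>X (\<Sum>i\<le>n. frag_cmul (c i) (cl (X i))) = (\<Otimes>\<^bsub>KX\<^esub>i\<in>{..n}. \<pi>X (cl (X i)) [^]\<^bsub>KX\<^esub> c i)" for n
  proof (induction n)
    case 0
    then show ?case using F[of 0] p[of 0] k[of 0] by (simp add: Pi_def)
  next
    case (Suc n)
    then have IH: "(\<Sum>i\<le>n. frag_cmul (c i) (cl (X i))) \<in> carrier FX"
        "\<pi>X (\<Sum>i\<le>n. frag_cmul (c i) (cl (X i))) = (\<Otimes>\<^bsub>KX\<^esub>i\<in>{..n}. \<pi>X (cl (X i)) [^]\<^bsub>KX\<^esub> c i)"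
      by simp_all
    have "(\<lambda>i. \<pi>X (cl (X i)) [^]\<^bsub>KX\<^esub> c i) \<in> {..Suc n} \<rightarrow> carrier KX" using k Suc.prems by auto
    from KX.finprod_Suc[OF this] show ?case
      using free_Abelian_group_hom_add[OF \<pi>X_hom F[OF Suc.prems] IH(1)] p[OF Suc.prems] IH(2)
        carrier_FX_add[OF F[OF Suc.prems] IH(1)] by (simp add: add.commute)
  qed
  then show ?thesis by blast
qed

lemma Grothendieck_groups_isomorphic:
  obtains \<phi> \<psi> where "group_isomorphisms KO KX \<phi> \<psi>"
    "\<And>n A g. euler n A g \<Longrightarrow> \<phi> (\<pi>O (cl A)) = \<pi>X g" "\<And>X. X \<in> \<XX> \<Longrightarrow> \<psi> (\<pi>X (cl X)) = \<pi>O (cl X)"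
proof -
  obtain \<phi> where \<phi>: "\<phi> \<in> hom KO KX" "\<And>A. A \<in> Obj \<C> \<Longrightarrow> \<phi> (\<pi>O (cl A)) = index (iso_class \<C> A)"
    by (rule index_hom_exists) blast
  obtain \<psi> where \<psi>: "\<psi> \<in> hom KX KO" "\<And>X. X \<in> \<XX> \<Longrightarrow> \<psi> (\<pi>X (cl X)) = \<pi>O (cl X)"
    by (rule inclusion_hom_exists) blast
  have \<phi>e: "\<phi> (\<pi>O (cl A)) = \<pi>X g" if "euler n A g" for n A g
    using \<phi>(2)[OF euler_Obj[OF that]] index_eq[OF that] by simp
  have gO: "group KO" and gX: "group KX"
    using comm_group.axioms(2)[OF comm_group_K0R] comm_group.axioms(2)[OF comm_group_K0sp] .
  have idO: "id \<in> hom KO KO" and idX: "id \<in> hom KX KX" by (auto intro: homI)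
  have "(\<psi> \<circ> \<phi>) (\<pi>O (frag_of c)) = id (\<pi>O (frag_of c))" if c: "c \<in> iso_class \<C> ` Obj \<C>" for c
  proof -
    obtain A where A: "A \<in> Obj \<C>" "c = iso_class \<C> A" using c by blast
    obtain n g where "euler n A g" using resolved[OF A(1)] by blast
    then show ?thesis using \<phi>e inclusion_hom_euler[OF \<psi>] A(2) by (simp add: cl_def)
  qed
  then have 1: "\<psi> (\<phi> u) = u" if "u \<in> carrier KO" for u
    using presented_group_hom_eq[OF gO K0R_relations_carrier, folded K0R_subgroup_def, folded K0R_def,
        OF hom_compose[OF \<phi>(1) \<psi>(1)] idO] that by simp
  have "(\<phi> \<circ> \<psi>) (\<pi>X (frag_of c)) = id (\<pi>X (frag_of c))" if c: "c \<in> iso_class \<C> ` \<XX>" for c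
  proof -
    obtain X where X: "X \<in> \<XX>" "c = iso_class \<C> X" using c by blast
    then show ?thesis using \<psi>(2)[OF X(1)] \<phi>(2)[OF XX_Obj[OF X(1)]] index_XX[OF X(1)] by (simp add: cl_def)
  qed
  then have 2: "\<phi> (\<psi> u) = u" if "u \<in> carrier KX" for u
    using presented_group_hom_eq[OF gX K0sp_relations_carrier, folded K0sp_subgroup_def, folded K0sp_def,
        OF hom_compose[OF \<psi>(1) \<phi>(1)] idX] that by simp
  have "group_isomorphisms KO KX \<phi> \<psi>"
    unfolding group_isomorphisms_def using \<phi>(1) \<psi>(1) 1 2 by blast
  with \<phi>e \<psi>(2) that show ?thesis by blast
qed

end

theorem corollary5p6:
  fixes \<C> :: "('o, 'm, 'z) tri_cat_scheme" and \<XX> \<N> :: "'o set"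
  assumes "triangulated_category \<C>"
    and "idempotent_complete \<C>"
    and "additive_subcategory \<C> \<XX>"
    and "contravariantly_finite \<C> \<XX>"
    and "rigid \<C> \<XX>"
    and "closed_under_summands \<C> \<XX>"
    and "\<N> = perp0 \<C> \<XX>"
    and "\<forall>A\<in>Obj \<C>. \<exists>m X d. resolutionR \<C> \<N> \<XX> A m X d"
  shows "\<exists>\<phi> \<psi>. group_isomorphisms (K0R \<C> \<N>) (K0sp \<C> \<XX>) \<phi> \<psi> \<and>
    (\<forall>A\<in>Obj \<C>. \<forall>m X d. resolutionR \<C> \<N> \<XX> A m X d \<longrightarrow>
       \<phi> (K0R_class \<C> \<N> A) =
         (\<Otimes>\<^bsub>K0sp \<C> \<XX>\<^esub>i\<in>{..m}. K0sp_class \<C> \<XX> (X i) [^]\<^bsub>K0sp \<C> \<XX>\<^esub> ((-1) ^ i :: int))) \<and>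
    (\<forall>X\<in>\<XX>. \<psi> (K0sp_class \<C> \<XX> X) = K0R_class \<C> \<N> X)"
proof -
  interpret rigid_approximating_subcategory \<C> \<XX>
    using assms(1,3,4,5)
    by (intro rigid_approximating_subcategory.intro rigid_approximating_subcategory_axioms.intro)
  interpret finitely_resolved \<C> \<XX>
  proof unfold_locales
    fix A assume "A \<in> Obj \<C>"
    then obtain m X d where "resolutionR \<C> (perp0 \<C> \<XX>) \<XX> A m X d" using assms(7,8) by blast
    then show "\<exists>n g. euler n A g" using resolutionR_euler by blast
  qed
  obtain \<phi> \<psi> where iso: "group_isomorphisms (K0R \<C> (perp0 \<C> \<XX>)) (K0sp \<C> \<XX>) \<phi> \<psi>"
    and \<phi>: "\<And>n A g. euler n A g \<Longrightarrow> \<phi> (K0R_subgroup \<C> (perp0 \<C> \<XX>) #>\<^bsub>FO\<^esub> cl A) = \<pi>X g"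
    and \<psi>: "\<And>X. X \<in> \<XX> \<Longrightarrow> \<psi> (\<pi>X (cl X)) = K0R_subgroup \<C> (perp0 \<C> \<XX>) #>\<^bsub>FO\<^esub> cl X"
    by (rule Grothendieck_groups_isomorphic) blast
  have "\<phi> (K0R_class \<C> (perp0 \<C> \<XX>) A) =
      (\<Otimes>\<^bsub>K0sp \<C> \<XX>\<^esub>i\<in>{..m}. K0sp_class \<C> \<XX> (X i) [^]\<^bsub>K0sp \<C> \<XX>\<^esub> ((-1) ^ i :: int))"
    if r: "resolutionR \<C> (perp0 \<C> \<XX>) \<XX> A m X d" for A m X d
    using \<phi>[OF resolutionR_euler[OF r]] \<pi>X_sum[of m X "\<lambda>i. (-1) ^ i"] r
    unfolding K0R_class_def K0sp_class_def cl_def resolutionR_def by simp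
  then show ?thesis
    unfolding assms(7) using iso \<psi> unfolding K0R_class_def K0sp_class_def cl_def by blast
qed

end
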